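(* Let $\sigma>0$, $D=(0,1)$, and let $m\in(-\tfrac2q,1]$ for some $q\in(1,\infty)$. Let $f$ be a real-valued centered microlocally isotropic Gaussian random field of order $-m$ compactly supported in $D$, with micro-correlation strength $\mu\in C_0^\infty(D)$, $\mu\ge0$. For each wave number $k>0$, let $$u(x)=\frac{1}{2\mathrm{i}\kappa}\int_D e^{\mathrm{i}\kappa|x-y|}f(y)\,dy$$ be the (outgoing, distributional) solution of $u''+(k^2+\mathrm{i}k\sigma)u=f$ in $\mathbb R$. Let $U\subset\mathbb R\setminus\overline D$ be a bounded open interval. Then for any $x\in U$, $$\lim_{k\to\infty}4k^{m+2}\,\mathbb E|u(x)|^2=\int_D e^{-\sigma|x-y|}\mu(y)\,dy.$$
   Context: Wave number: $\kappa=\kappa(k)$ is the complex number with $\kappa^2=k^2+\mathrm{i}k\sigma$ and positive real and imaginary parts. Random source: $f$ is a random distribution (an element of $\mathcal D'$, the dual of $\mathcal D=C_0^\infty(\mathbb R)$), independent of $k$, with mean $E_f$ given by $\langle E_f,\varphi\rangle=\mathbb E\langle f,\varphi\rangle$ and covariance operator $Q_f$ given by $\langle\varphi,Q_f\psi\rangle=\mathbb E[\langle f,\varphi\rangle\langle f,\psi\rangle]$ for $\varphi,\psi\in\mathcal D$. "Centered" means $E_f=0$. "Microlocally isotropic of order $-m$ with micro-correlation strength $\mu$" means that $Q_f$ is a classical pseudo-differential operator, $(Q_f\psi)(x)=\frac1{2\pi}\int_{\mathbb R}e^{\mathrm{i}x\xi}c(x,\xi)\hat\psi(\xi)\,d\xi$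 with $\hat\psi(\xi)=\int_{\mathbb R}e^{-\mathrm{i}x\xi}\psi(x)\,dx$, whose symbol $c$ has principal part $\mu(x)|\xi|^{-m}$ (the remainder after the principal part is a symbol of order $-m-1$). The integral defining $u(x)$ is understood as the dual pairing of the compactly supported distribution $f$ with $y\mapsto e^{\mathrm{i}\kappa|x-y|}$, which is smooth on $D$ when $x\in U$. *)

theory Defs
  imports "HOL-Probability.Probability"
begin

subsection \<open>Smooth functions and test functions\<close>

text \<open>Iterated directional derivatives; the head of the list is the direction of the last
  differentiation.\<close>

primrec iter_deriv ::
    "'a list \<Rightarrow> ('a::real_normed_vector \<Rightarrow> 'b::real_normed_vector) \<Rightarrow> 'a \<Rightarrow> 'b" where
  "iter_deriv [] g = g"
| "iter_deriv (v # vs) g = (\<lambda>x. frechet_derivative (iter_deriv vs g) (at x) v)"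

text \<open>Meant for open \<open>S\<close>. Since differentiability is Frechet differentiability, this is the usual
  class of functions all of whose iterated partial derivatives exist and are continuous.\<close>

definition smooth_on ::
    "'a::real_normed_vector set \<Rightarrow> ('a \<Rightarrow> 'b::real_normed_vector) \<Rightarrow> bool" where
  "smooth_on S g \<longleftrightarrow> (\<forall>vs. \<forall>x\<in>S. iter_deriv vs g differentiable (at x))"

definition tsupp :: "('a::topological_space \<Rightarrow> 'b::zero) \<Rightarrow> 'a set" where
  "tsupp g = closure {x. g x \<noteq> 0}"

definition test_function_on :: "real set \<Rightarrow> (real \<Rightarrow> 'b::real_normed_vector) \<Rightarrow> bool" where
  "test_function_on V \<phi> \<longleftrightarrow> smooth_on UNIV \<phi> \<and> compact (tsupp \<phi>) \<and> tsupp \<phi> \<subseteq> V"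

abbreviation test_function :: "(real \<Rightarrow> complex) \<Rightarrow> bool" where
  "test_function \<equiv> test_function_on UNIV"

subsection \<open>Distributions on the real line\<close>

text \<open>A distribution is represented by a functional on all functions of type
  \<open>real \<Rightarrow> complex\<close>, of which only the values on test functions matter.\<close>

definition distribution :: "((real \<Rightarrow> complex) \<Rightarrow> complex) \<Rightarrow> bool" where
  "distribution F \<longleftrightarrow>
     (\<forall>\<phi> \<psi>. test_function \<phi> \<longrightarrow> test_function \<psi> \<longrightarrow> F (\<lambda>x. \<phi> x + \<psi> x) = F \<phi> + F \<psi>) \<and>
     (\<forall>z \<phi>. test_function \<phi> \<longrightarrow> F (\<lambda>x. z * \<phi> x) = z * F \<phi>) \<and>
     (\<forall>K. compact K \<longrightarrow>
        (\<exists>C N. \<forall>\<phi>. test_function \<phi> \<and> tsupp \<phi> \<subseteq> K \<longrightarrow>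
           norm (F \<phi>) \<le> C * (\<Sum>n\<le>N. SUP x. norm (iter_deriv (replicate n 1) \<phi> x))))"

definition real_valued_distribution :: "((real \<Rightarrow> complex) \<Rightarrow> complex) \<Rightarrow> bool" where
  "real_valued_distribution F \<longleftrightarrow>
     distribution F \<and> (\<forall>\<phi>. test_function \<phi> \<longrightarrow> (\<forall>x. \<phi> x \<in> \<real>) \<longrightarrow> F \<phi> \<in> \<real>)"

definition dist_supp :: "((real \<Rightarrow> complex) \<Rightarrow> complex) \<Rightarrow> real set" where
  "dist_supp F = - \<Union>{V. open V \<and> (\<forall>\<phi>. test_function_on V \<phi> \<longrightarrow> F \<phi> = 0)}"

text \<open>The pairing of a distribution with compact support in the open set \<open>V\<close> and a function
  that is smooth on \<open>V\<close>: multiply the function by a cutoff which is supported in \<open>V\<close> and equals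
  \<open>1\<close> near the support of the distribution; the value does not depend on the cutoff.\<close>

definition ext_pairing ::
    "real set \<Rightarrow> ((real \<Rightarrow> complex) \<Rightarrow> complex) \<Rightarrow> (real \<Rightarrow> complex) \<Rightarrow> complex" where
  "ext_pairing V F g = (THE z. \<forall>\<eta>. test_function_on V \<eta> \<and>
       (\<exists>W. open W \<and> dist_supp F \<subseteq> W \<and> (\<forall>y\<in>W. \<eta> y = 1)) \<longrightarrow> F (\<lambda>y. \<eta> y * g y) = z)"

subsection \<open>Random distributions\<close>

definition random_distribution ::
    "'w measure \<Rightarrow> ('w \<Rightarrow> (real \<Rightarrow> complex) \<Rightarrow> complex) \<Rightarrow> bool" where
  "random_distribution M f \<longleftrightarrow>
     (\<forall>\<omega>\<in>space M. distribution (f \<omega>)) \<and>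
     (\<forall>\<phi>. test_function \<phi> \<longrightarrow> (\<lambda>\<omega>. f \<omega> \<phi>) \<in> borel_measurable M)"

definition mean_dist ::
    "'w measure \<Rightarrow> ('w \<Rightarrow> (real \<Rightarrow> complex) \<Rightarrow> complex) \<Rightarrow> (real \<Rightarrow> complex) \<Rightarrow> complex" where
  "mean_dist M f \<phi> = (\<integral>\<omega>. f \<omega> \<phi> \<partial>M)"

definition centered :: "'w measure \<Rightarrow> ('w \<Rightarrow> (real \<Rightarrow> complex) \<Rightarrow> complex) \<Rightarrow> bool" where
  "centered M f \<longleftrightarrow> (\<forall>\<phi>. test_function \<phi> \<longrightarrow> mean_dist M f \<phi> = 0)"

text \<open>The covariance operator sends \<open>\<psi>\<close> to the distribution
  \<open>\<phi> \<mapsto> E[f(\<phi>) f(\<psi>)]\<close>; the pairing is bilinear, there is no complex conjugation.\<close>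

definition covariance_op :: "'w measure \<Rightarrow> ('w \<Rightarrow> (real \<Rightarrow> complex) \<Rightarrow> complex) \<Rightarrow>
    (real \<Rightarrow> complex) \<Rightarrow> (real \<Rightarrow> complex) \<Rightarrow> complex" where
  "covariance_op M f \<psi> = (\<lambda>\<phi>. \<integral>\<omega>. f \<omega> \<phi> * f \<omega> \<psi> \<partial>M)"

definition gaussian_rv :: "'w measure \<Rightarrow> ('w \<Rightarrow> real) \<Rightarrow> bool" where
  "gaussian_rv M X \<longleftrightarrow> X \<in> borel_measurable M \<and>
     ((\<exists>a s. s > 0 \<and> distributed M lborel X (\<lambda>t. ennreal (normal_density a s t))) \<or>
      (\<exists>a. AE \<omega> in M. X \<omega> = a))"

text \<open>For a real-valued random distribution. By linearity in the test function, every finite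
  family of pairings is then jointly Gaussian.\<close>

definition gaussian_field :: "'w measure \<Rightarrow> ('w \<Rightarrow> (real \<Rightarrow> complex) \<Rightarrow> complex) \<Rightarrow> bool" where
  "gaussian_field M f \<longleftrightarrow>
     (\<forall>\<phi>. test_function \<phi> \<longrightarrow> (\<forall>x. \<phi> x \<in> \<real>) \<longrightarrow> gaussian_rv M (\<lambda>\<omega>. Re (f \<omega> \<phi>)))"

subsection \<open>Classical pseudo-differential operators\<close>

definition is_symbol :: "real \<Rightarrow> (real \<times> real \<Rightarrow> complex) \<Rightarrow> bool" where
  "is_symbol r c \<longleftrightarrow> smooth_on UNIV c \<and>
     (\<forall>K \<alpha> \<beta>. compact K \<longrightarrow> (\<exists>C. \<forall>x\<in>K. \<forall>\<xi>.
        norm (iter_deriv (replicate \<alpha> (1, 0) @ replicate \<beta> (0, 1)) c (x, \<xi>))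
          \<le> C * (1 + \<bar>\<xi>\<bar>) powr (r - real \<beta>)))"

text \<open>Polyhomogeneous symbols of order \<open>r\<close> with principal part \<open>p\<close>. The terms of the expansion
  are homogeneous and in general singular at \<open>\<xi> = 0\<close>, hence the excision function \<open>\<eta>\<close>.
  The condition for \<open>N = 0\<close> says that \<open>c\<close> has order \<open>r\<close>, the one for \<open>N = 1\<close>
  that the remainder after the principal part has order \<open>r - 1\<close>.\<close>

definition classical_symbol ::
    "real \<Rightarrow> (real \<times> real \<Rightarrow> complex) \<Rightarrow> (real \<times> real \<Rightarrow> complex) \<Rightarrow> bool" where
  "classical_symbol r c p \<longleftrightarrow>
     (\<exists>(\<eta> :: real \<Rightarrow> real) (a :: nat \<Rightarrow> real \<times> real \<Rightarrow> complex).
        smooth_on UNIV \<eta> \<and>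
        (\<forall>\<xi>. \<bar>\<xi>\<bar> \<le> 1 / 2 \<longrightarrow> \<eta> \<xi> = 0) \<and> (\<forall>\<xi>. \<bar>\<xi>\<bar> \<ge> 1 \<longrightarrow> \<eta> \<xi> = 1) \<and>
        (\<forall>j. smooth_on (UNIV \<times> (- {0})) (a j)) \<and>
        (\<forall>j x \<xi> t. \<xi> \<noteq> 0 \<longrightarrow> t > 0 \<longrightarrow>
           a j (x, t * \<xi>) = of_real (t powr (r - real j)) * a j (x, \<xi>)) \<and>
        (\<forall>x \<xi>. \<xi> \<noteq> 0 \<longrightarrow> a 0 (x, \<xi>) = p (x, \<xi>)) \<and>
        (\<forall>N. is_symbol (r - real N)
           (\<lambda>(x, \<xi>). c (x, \<xi>) - of_real (\<eta> \<xi>) * (\<Sum>j<N. a j (x, \<xi>)))))"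

definition fourier :: "(real \<Rightarrow> complex) \<Rightarrow> real \<Rightarrow> complex" where
  "fourier \<psi> \<xi> = (\<integral>x. exp (- \<i> * of_real (x * \<xi>)) * \<psi> x \<partial>lborel)"

definition psido :: "(real \<times> real \<Rightarrow> complex) \<Rightarrow> (real \<Rightarrow> complex) \<Rightarrow> real \<Rightarrow> complex" where
  "psido c \<psi> x =
     of_real (1 / (2 * pi)) * (\<integral>\<xi>. exp (\<i> * of_real (x * \<xi>)) * c (x, \<xi>) * fourier \<psi> \<xi> \<partial>lborel)"

text \<open>Microlocally isotropic of order \<open>- m\<close> with micro-correlation strength \<open>\<mu>\<close>: the
  distribution \<open>covariance_op M f \<psi>\<close> is the function \<open>psido c \<psi>\<close>.\<close>

definition microlocally_isotropic :: "'w measure \<Rightarrow>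
    ('w \<Rightarrow> (real \<Rightarrow> complex) \<Rightarrow> complex) \<Rightarrow> real \<Rightarrow> (real \<Rightarrow> real) \<Rightarrow> bool" where
  "microlocally_isotropic M f m \<mu> \<longleftrightarrow>
     (\<exists>c. classical_symbol (- m) c (\<lambda>(x, \<xi>). of_real (\<mu> x * \<bar>\<xi>\<bar> powr (- m))) \<and>
        (\<forall>\<phi> \<psi>. test_function \<phi> \<longrightarrow> test_function \<psi> \<longrightarrow>
           covariance_op M f \<psi> \<phi> = (\<integral>x. \<phi> x * psido c \<psi> x \<partial>lborel)))"

subsection \<open>The radiated field\<close>

definition wave_number :: "real \<Rightarrow> real \<Rightarrow> complex" where
  "wave_number \<sigma> k =
     (THE \<kappa>. \<kappa>\<^sup>2 = of_real (k\<^sup>2) + \<i> * of_real (k * \<sigma>) \<and> Re \<kappa> > 0 \<and> Im \<kappa> > 0)"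

text \<open>Meant for \<open>F\<close> with compact support in the open set \<open>D\<close> and \<open>x\<close> outside \<open>D\<close>, where
  \<open>y \<mapsto> exp (\<i> \<kappa> \<bar>x - y\<bar>)\<close> is smooth on \<open>D\<close>.\<close>

definition radiated_field ::
    "real \<Rightarrow> real \<Rightarrow> real set \<Rightarrow> ((real \<Rightarrow> complex) \<Rightarrow> complex) \<Rightarrow> real \<Rightarrow> complex" where
  "radiated_field \<sigma> k D F x =
     1 / (2 * \<i> * wave_number \<sigma> k) *
       ext_pairing D F (\<lambda>y. exp (\<i> * wave_number \<sigma> k * of_real \<bar>x - y\<bar>))"

end

theory Submission
  imports Defs "HOL-Real_Asymp.Real_Asymp"
begin

text \<open>Seen from a point \<open>x\<close> on one side of \<open>D\<close>, the kernel \<open>exp (\<i> \<kappa> \<bar>x - y\<bar>)\<close> is a plane wave in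
  \<open>y\<close> with a frequency of size \<open>k\<close> and the damping rate \<open>Im \<kappa> \<rightarrow> \<sigma> / 2\<close>. The second moment of the
  field therefore probes the covariance operator at the frequency \<open>k\<close>, where its symbol is
  asymptotic to \<open>\<mu>(y) k\<^sup>-\<^sup>m\<close>; the damping enters twice and gives \<open>exp (- \<sigma> \<bar>x - y\<bar>)\<close>, and the factor
  \<open>1 / (4 \<bar>\<kappa>\<bar>\<^sup>2)\<close> in front of the pairing accounts for the remaining power of \<open>k\<close>.

  The pairing of a realization with the kernel needs a cutoff around its support, and these
  supports need not lie in one compact subset of \<open>D\<close>. That they do so almost surely is a
  consequence of Gaussianity, \<open>gaussian_field_uniform_support\<close>: a field that is
  not almost surely zero arbitrarily near the boundary would be almost surely nonzero on all
  members of a sequence of test functions that escape to the boundary, while every realization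
  vanishes on all but finitely many of them. Hence
  one cutoff \<open>\<eta>\<close> serves almost every realization (\<open>ext_pairing_random\<close>), and it may be chosen equal
  to \<open>1\<close> where \<open>\<mu>\<close> is nonzero. Now \<open>E \<bar>f(\<phi>)\<bar>\<^sup>2\<close> for \<open>\<phi>(y) = \<eta>(y) exp (\<i> \<kappa> s (y - x))\<close>, where
  \<open>s = \<plusminus>1\<close> is the side on which \<open>D\<close> lies, is a value of the covariance, that is, a double integral.

  Shifting the frequency variable by the frequency of the plane wave (\<open>psido_modulated\<close>) moves the
  oscillation into the symbol, whose argument becomes \<open>\<tau> - s Re \<kappa>\<close>, and leaves the Fourier-Laplace
  transform of \<open>\<eta>\<close> at \<open>\<tau> - \<i> s Im \<kappa>\<close>. The latter decays faster than any power of \<open>\<tau>\<close>, uniformly in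
  a strip, while the former, multiplied by \<open>k\<^sup>m\<close>, is bounded by a power of \<open>1 + \<bar>\<tau>\<bar>\<close> and tends to
  \<open>\<mu>(y)\<close>. Dominated convergence, first in \<open>\<tau>\<close> and then in \<open>y\<close>, leaves an integral over \<open>\<tau>\<close> that
  Fourier inversion evaluates (\<open>modulated_covariance_limit\<close>).\<close>

section \<open>Smooth functions of one real variable\<close>

lemma iter_deriv_append: "iter_deriv (vs @ ws) g = iter_deriv vs (iter_deriv ws g)"
  by (induction vs) auto

lemma smooth_on_derivative:
  fixes g :: "real \<Rightarrow> 'b::real_normed_vector"
  assumes "smooth_on UNIV g"
  shows "\<exists>g'. smooth_on UNIV g' \<and> (\<forall>x. (g has_vector_derivative g' x) (at x))"
proof (intro exI[of _ "iter_deriv [1] g"] conjI allI)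
  show "smooth_on UNIV (iter_deriv [1] g)"
    using assms unfolding smooth_on_def iter_deriv_append[symmetric] by blast
  fix x
  have "g differentiable (at x)"
    using assms unfolding smooth_on_def by (metis UNIV_I iter_deriv.simps(1))
  then have d: "(g has_derivative frechet_derivative g (at x)) (at x)"
    by (simp add: frechet_derivative_works)
  moreover have "frechet_derivative g (at x) = (\<lambda>h. h *\<^sub>R frechet_derivative g (at x) 1)"
    using linear_frechet_derivative[OF \<open>g differentiable (at x)\<close>]
    by (metis linear_scale mult.right_neutral real_scaleR_def)
  ultimately show "(g has_vector_derivative iter_deriv [1] g x) (at x)"
    unfolding has_vector_derivative_def by simp
qed

text \<open>On the line an iterated directional derivative is a scalar multiple of an ordinary one, so
  smoothness is a greatest fixed point of differentiation. The closure properties below then need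
  one differentiation step only.\<close>

lemma smooth_on_coinduct:
  fixes g :: "real \<Rightarrow> 'b::real_normed_vector"
  assumes "g \<in> \<F>"
    and step: "\<And>u. u \<in> \<F> \<Longrightarrow> \<exists>u'\<in>\<F>. \<forall>x. (u has_vector_derivative u' x) (at x)"
  shows "smooth_on UNIV g"
proof -
  have "\<exists>u\<in>\<F>. \<exists>r. iter_deriv vs g = (\<lambda>x. r *\<^sub>R u x)" for vs
  proof (induction vs)
    case Nil
    then show ?case using assms(1) by (intro bexI[of _ g] exI[of _ 1]) auto
  next
    case (Cons v vs)
    then obtain u r where u: "u \<in> \<F>" "iter_deriv vs g = (\<lambda>x. r *\<^sub>R u x)" by blast
    obtain u' where u': "u' \<in> \<F>" "\<And>x. (u has_vector_derivative u' x) (at x)"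
      using step[OF u(1)] by blast
    have "frechet_derivative (\<lambda>x. r *\<^sub>R u x) (at x) = (\<lambda>h. r *\<^sub>R (h *\<^sub>R u' x))" for x
      using u'(2)[of x] unfolding has_vector_derivative_def
      by (metis frechet_derivative_at has_derivative_scaleR_right)
    then have "iter_deriv (v # vs) g = (\<lambda>x. (r * v) *\<^sub>R u' x)"
      by (simp add: u(2))
    then show ?case using u'(1) by blast
  qed
  note main = this
  have diff: "(\<lambda>x. r *\<^sub>R u x) differentiable (at x)" if "u \<in> \<F>" for u r x
  proof -
    have "u differentiable (at x)"
      using step[OF that] differentiableI_vector by blast
    then show ?thesis by simp
  qed
  show ?thesis
    unfolding smooth_on_def
  proof (intro allI ballI)
    fix vs x
    obtain u r where "u \<in> \<F>" "iter_deriv vs g = (\<lambda>x. r *\<^sub>R u x)"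
      using main by blast
    then show "iter_deriv vs g differentiable (at x)" using diff by simp
  qed
qed

lemma smooth_on_continuous:
  fixes g :: "real \<Rightarrow> 'b::real_normed_vector"
  assumes "smooth_on UNIV g"
  shows "continuous_on A g"
proof -
  obtain g' where "smooth_on UNIV g'" "\<And>x. (g has_vector_derivative g' x) (at x)"
    using smooth_on_derivative[OF assms] by blast
  then show ?thesis
    by (blast intro: continuous_at_imp_continuous_on has_vector_derivative_continuous)
qed

lemma smooth_on_const: "smooth_on UNIV (\<lambda>x::real. a :: 'b::real_normed_vector)"
  by (rule smooth_on_coinduct[where \<F> = "range (\<lambda>a x. a)"])
     (auto intro!: derivative_eq_intros)

lemma smooth_on_add:
  fixes u v :: "real \<Rightarrow> 'b::real_normed_vector"
  assumes "smooth_on UNIV u" "smooth_on UNIV v"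
  shows "smooth_on UNIV (\<lambda>x. u x + v x)"
proof (rule smooth_on_coinduct[where
      \<F> = "{w. \<exists>u v. smooth_on UNIV u \<and> smooth_on UNIV v \<and> w = (\<lambda>x::real. u x + v x)}"], goal_cases)
  case 1
  then show ?case using assms by blast
next
  case (2 w)
  then obtain u v where w: "smooth_on UNIV u" "smooth_on UNIV v" "w = (\<lambda>x. u x + v x)" by blast
  obtain u' where "smooth_on UNIV u'" "\<And>x. (u has_vector_derivative u' x) (at x)"
    using smooth_on_derivative[OF w(1)] by blast
  moreover obtain v' where "smooth_on UNIV v'" "\<And>x. (v has_vector_derivative v' x) (at x)"
    using smooth_on_derivative[OF w(2)] by blast
  ultimately
  show ?case
    unfolding w(3) by (intro bexI[of _ "\<lambda>x. u' x + v' x"]) (auto intro!: derivative_eq_intros)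
qed

lemma smooth_on_linear_image:
  fixes u :: "real \<Rightarrow> 'b::real_normed_vector" and L :: "'b \<Rightarrow> 'c::real_normed_vector"
  assumes L: "bounded_linear L" and "smooth_on UNIV u"
  shows "smooth_on UNIV (\<lambda>x. L (u x))"
proof (rule smooth_on_coinduct[where
      \<F> = "{w. \<exists>u. smooth_on UNIV u \<and> w = (\<lambda>x::real. L (u x))}"], goal_cases)
  case 1
  then show ?case using assms by blast
next
  case (2 w)
  then obtain u where w: "smooth_on UNIV u" "w = (\<lambda>x. L (u x))" by blast
  obtain u' where "smooth_on UNIV u'" "\<And>x. (u has_vector_derivative u' x) (at x)"
    using smooth_on_derivative[OF w(1)] by blast
  then show ?case
    unfolding w(2)
    by (intro bexI[of _ "\<lambda>x. L (u' x)"]) (auto intro!: bounded_linear.has_vector_derivative[OF L])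
qed

lemma smooth_on_affine:
  fixes u :: "real \<Rightarrow> 'b::real_normed_vector"
  assumes "smooth_on UNIV u"
  shows "smooth_on UNIV (\<lambda>x. u (a * x + b))"
proof (rule smooth_on_coinduct[where
      \<F> = "{w. \<exists>u r. smooth_on UNIV u \<and> w = (\<lambda>x::real. r *\<^sub>R u (a * x + b))}"], goal_cases)
  case 1
  then show ?case using assms by (auto intro!: exI[of _ u] exI[of _ 1])
next
  case (2 w)
  then obtain u r where w: "smooth_on UNIV u" "w = (\<lambda>x. r *\<^sub>R u (a * x + b))" by blast
  obtain u' where u': "smooth_on UNIV u'" "\<And>x. (u has_vector_derivative u' x) (at x)"
    using smooth_on_derivative[OF w(1)] by blast
  have "((\<lambda>x. u (a * x + b)) has_vector_derivative a *\<^sub>R u' (a * x + b)) (at x)" for x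
  proof -
    have "((\<lambda>x. a * x + b) has_vector_derivative a) (at x)"
      by (auto simp: has_real_derivative_iff_has_vector_derivative[symmetric]
          intro!: derivative_eq_intros)
    from vector_diff_chain_at[OF this u'(2)] show ?thesis by (simp add: o_def)
  qed
  then have "(w has_vector_derivative (r * a) *\<^sub>R u' (a * x + b)) (at x)" for x
    unfolding w(2) by (auto intro!: derivative_eq_intros)
  then show ?case
    using u'(1) by (intro bexI[of _ "\<lambda>x. (r * a) *\<^sub>R u' (a * x + b)"]) auto
qed

lemma smooth_on_exp: "smooth_on UNIV (\<lambda>x. exp (a * complex_of_real x))"
proof (rule smooth_on_coinduct[where \<F> = "range (\<lambda>b x. b * exp (a * complex_of_real x))"], goal_cases)
  case 1
  then show ?case by (auto intro!: image_eqI[of _ _ 1])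
next
  case (2 w)
  then obtain b where w: "w = (\<lambda>x. b * exp (a * complex_of_real x))" by blast
  have "(w has_vector_derivative (b * a) * exp (a * complex_of_real x)) (at x)" for x
    unfolding w
    by (rule has_vector_derivative_real_field) (auto intro!: derivative_eq_intros)
  then show ?case by (intro bexI[of _ "\<lambda>x. (b * a) * exp (a * complex_of_real x)"]) auto
qed

text \<open>By the Leibniz rule the derivative of a product is a sum of two products; iterating stays
  inside the set of finite sums of products of smooth functions.\<close>

inductive_set sums_of_products :: "(real \<Rightarrow> 'b::real_normed_algebra) set" where
  product: "smooth_on UNIV u \<Longrightarrow> smooth_on UNIV v \<Longrightarrow> (\<lambda>x. u x * v x) \<in> sums_of_products"
| sum: "p \<in> sums_of_products \<Longrightarrow> q \<in> sums_of_products \<Longrightarrow> (\<lambda>x. p x + q x) \<in> sums_of_products"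

lemma smooth_on_mult:
  fixes u v :: "real \<Rightarrow> 'b::real_normed_algebra"
  assumes "smooth_on UNIV u" "smooth_on UNIV v"
  shows "smooth_on UNIV (\<lambda>x. u x * v x)"
proof (rule smooth_on_coinduct[where \<F> = sums_of_products])
  show "(\<lambda>x. u x * v x) \<in> sums_of_products"
    using assms by (rule product)
next
  fix w :: "real \<Rightarrow> 'b"
  assume "w \<in> sums_of_products"
  then show "\<exists>w'\<in>sums_of_products. \<forall>x. (w has_vector_derivative w' x) (at x)"
  proof induction
    case (product u v)
    obtain u' where du: "smooth_on UNIV u'" "\<And>x. (u has_vector_derivative u' x) (at x)"
      using smooth_on_derivative[OF product(1)] by blast
    obtain v' where dv: "smooth_on UNIV v'" "\<And>x. (v has_vector_derivative v' x) (at x)"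
      using smooth_on_derivative[OF product(2)] by blast
    have "((\<lambda>x. u x * v x) has_vector_derivative (u x * v' x + u' x * v x)) (at x)" for x
      by (rule has_vector_derivative_mult[OF du(2) dv(2)])
    moreover have "(\<lambda>x. u x * v' x + u' x * v x) \<in> sums_of_products"
      using product du dv by (intro sums_of_products.intros)
    ultimately show ?case by (intro bexI[of _ "\<lambda>x. u x * v' x + u' x * v x"] allI)
  next
    case (sum p q)
    then obtain p' q' where "p' \<in> sums_of_products" "q' \<in> sums_of_products"
      "\<And>x. (p has_vector_derivative p' x) (at x)" "\<And>x. (q has_vector_derivative q' x) (at x)"
      by blast
    then show ?case
      by (intro bexI[of _ "\<lambda>x. p' x + q' x"])
         (auto intro: sums_of_products.sum has_vector_derivative_add)
  qed
qed

lemma smooth_on_diff: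
  fixes u v :: "real \<Rightarrow> 'b::real_normed_vector"
  assumes "smooth_on UNIV u" "smooth_on UNIV v"
  shows "smooth_on UNIV (\<lambda>x. u x - v x)"
  using smooth_on_add[OF assms(1) smooth_on_linear_image[OF bounded_linear_minus[OF bounded_linear_ident] assms(2)]]
  by simp

section \<open>Test functions, steps and cutoffs\<close>

lemma tsupp_mono: "(\<And>x. g x = 0 \<Longrightarrow> h x = 0) \<Longrightarrow> tsupp h \<subseteq> tsupp g"
  unfolding tsupp_def by (intro closure_mono) auto

lemma tsupp_subset_closed: "closed K \<Longrightarrow> (\<And>x. x \<notin> K \<Longrightarrow> g x = 0) \<Longrightarrow> tsupp g \<subseteq> K"
  unfolding tsupp_def by (intro closure_minimal) auto

lemma not_in_tsupp: "x \<notin> tsupp g \<Longrightarrow> g x = 0"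
  unfolding tsupp_def by (metis (mono_tags) closure_subset mem_Collect_eq subsetD)

lemma compact_tsupp: "compact K \<Longrightarrow> tsupp g \<subseteq> K \<Longrightarrow> compact (tsupp g)"
  using compact_Int_closed[of K "tsupp g"] by (simp add: tsupp_def inf.absorb2)

lemma test_function_on_subset: "test_function_on V \<phi> \<Longrightarrow> tsupp \<phi> \<subseteq> W \<Longrightarrow> test_function_on W \<phi>"
  unfolding test_function_on_def by auto

lemma test_function_on_imp_test_function: "test_function_on V \<phi> \<Longrightarrow> test_function \<phi>"
  unfolding test_function_on_def by auto

lemma test_function_on_shrink:
  assumes "test_function_on V \<phi>" "smooth_on UNIV \<psi>" "\<And>x. \<phi> x = 0 \<Longrightarrow> \<psi> x = 0"
  shows "test_function_on V \<psi>"
proof -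
  have "tsupp \<psi> \<subseteq> tsupp \<phi>"
    using assms(3) by (rule tsupp_mono)
  moreover from this have "compact (tsupp \<psi>)"
    using assms(1) unfolding test_function_on_def by (auto intro: compact_tsupp[of "tsupp \<phi>" \<psi>])
  ultimately show ?thesis
    using assms(1,2) unfolding test_function_on_def by auto
qed

lemma test_function_on_mult:
  fixes \<phi> u :: "real \<Rightarrow> 'b::real_normed_algebra"
  assumes "test_function_on V \<phi>" "smooth_on UNIV u"
  shows "test_function_on V (\<lambda>x. \<phi> x * u x)"
proof (rule test_function_on_shrink[OF assms(1)])
  show "smooth_on UNIV (\<lambda>x. \<phi> x * u x)"
    using assms smooth_on_mult unfolding test_function_on_def by blast
qed simp

lemma test_function_add:
  assumes "test_function \<phi>" "test_function \<psi>"
  shows "test_function (\<lambda>x. \<phi> x + \<psi> x)"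
proof -
  have "tsupp (\<lambda>x. \<phi> x + \<psi> x) \<subseteq> tsupp \<phi> \<union> tsupp \<psi>"
  proof (rule tsupp_subset_closed)
    show "closed (tsupp \<phi> \<union> tsupp \<psi>)" unfolding tsupp_def by (intro closed_Un closed_closure)
    show "\<phi> x + \<psi> x = 0" if "x \<notin> tsupp \<phi> \<union> tsupp \<psi>" for x
      using that not_in_tsupp[of x \<phi>] not_in_tsupp[of x \<psi>] by simp
  qed
  moreover have "compact (tsupp \<phi> \<union> tsupp \<psi>)"
    using assms unfolding test_function_on_def by auto
  ultimately have "compact (tsupp (\<lambda>x. \<phi> x + \<psi> x))"
    by (rule compact_tsupp[rotated])
  then show ?thesis
    using assms smooth_on_add unfolding test_function_on_def by auto
qed

text \<open>A smooth step is all that is needed for cutoffs and partitions of unity on the line.\<close>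

definition smooth_step :: "(real \<Rightarrow> real) \<Rightarrow> bool" where
  "smooth_step S \<longleftrightarrow> smooth_on UNIV S \<and> (\<forall>t\<le>1/2. S t = 0) \<and> (\<forall>t\<ge>1. S t = 1)"

text \<open>Every classical symbol comes with an excision function, and its right half is a step; so no
  bump function has to be constructed. Gluing with the zero function is harmless because all
  derivatives of an excision function vanish near the origin.\<close>

lemma smooth_step_of_excision:
  fixes \<eta> :: "real \<Rightarrow> real"
  assumes "smooth_on UNIV \<eta>" "\<And>t. \<bar>t\<bar> \<le> 1/2 \<Longrightarrow> \<eta> t = 0" "\<And>t. \<bar>t\<bar> \<ge> 1 \<Longrightarrow> \<eta> t = 1"
  shows "smooth_step (\<lambda>t. if t \<le> 0 then 0 else \<eta> t)"
proof -
  have "smooth_on UNIV (\<lambda>t. if t \<le> 0 then 0 else \<eta> t)"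
  proof (rule smooth_on_coinduct[where \<F> = "{w. \<exists>u. smooth_on UNIV u \<and> (\<forall>t. \<bar>t\<bar> < 1/2 \<longrightarrow> u t = 0) \<and>
        w = (\<lambda>t::real. if t \<le> 0 then 0 else u t)}"], goal_cases)
    case 1
    then show ?case using assms by (auto intro!: exI[of _ \<eta>])
  next
    case (2 w)
    then obtain u where u: "smooth_on UNIV u" "\<And>t. \<bar>t\<bar> < 1/2 \<Longrightarrow> u t = 0"
      "w = (\<lambda>t. if t \<le> 0 then 0 else u t)" by blast
    obtain u' where u': "smooth_on UNIV u'" "\<And>x. (u has_vector_derivative u' x) (at x)"
      using smooth_on_derivative[OF u(1)] by blast
    have z: "u' t = 0" if "\<bar>t\<bar> < 1/2" for t
    proof -
      have "(u has_vector_derivative 0) (at t)"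
        by (rule has_vector_derivative_transform_within_open[of "\<lambda>_. 0" _ _ "{-1/2<..<1/2}"])
           (use that u(2) in auto)
      then show ?thesis using u'(2) vector_derivative_unique_at by blast
    qed
    have "(w has_vector_derivative (if t \<le> 0 then 0 else u' t)) (at t)" for t
    proof (cases "t < 1/2")
      case True
      have "(w has_vector_derivative 0) (at t)"
        by (rule has_vector_derivative_transform_within_open[of "\<lambda>_. 0" _ _ "{..<1/2}"])
           (use True u in auto)
      then show ?thesis using z True by auto
    next
      case False
      have "(w has_vector_derivative u' t) (at t)"
        by (rule has_vector_derivative_transform_within_open[of u _ _ "{0<..}"])
           (use False u u' in auto)
      then show ?thesis using False by auto
    qed
    moreover have "(\<lambda>t. if t \<le> 0 then 0 else u' t) \<in> {w. \<exists>u. smooth_on UNIV u \<and>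
        (\<forall>t. \<bar>t\<bar> < 1/2 \<longrightarrow> u t = 0) \<and> w = (\<lambda>t::real. if t \<le> 0 then 0 else u t)}"
      using u'(1) z by (intro CollectI exI[of _ u']) simp
    ultimately show ?case by (intro bexI allI)
  qed
  then show ?thesis using assms unfolding smooth_step_def by auto
qed

text \<open>As \<open>A\<close> grows, the cutoffs exhaust the unit interval: inside it the value is \<open>1\<close> at distance
  at least \<open>1 / A\<close> from the boundary and \<open>0\<close> at distance at most \<open>1 / (2 * A)\<close>.\<close>

definition cutoff :: "(real \<Rightarrow> real) \<Rightarrow> real \<Rightarrow> real \<Rightarrow> complex" where
  "cutoff S A y = of_real (S (A * y) * S (A * (1 - y)))"

lemma smooth_on_step_affine:
  "smooth_step S \<Longrightarrow> smooth_on UNIV (\<lambda>y. complex_of_real (S (a * y + b)))"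
  unfolding smooth_step_def
  by (intro smooth_on_linear_image[OF bounded_linear_of_real] smooth_on_affine) auto

lemma test_function_cutoff:
  assumes S: "smooth_step S" and "A > 0"
  shows "test_function_on {0<..<1} (cutoff S A)"
proof -
  have "smooth_on UNIV (cutoff S A)"
    using smooth_on_mult[OF smooth_on_step_affine[OF S, of A 0] smooth_on_step_affine[OF S, of "-A" A]]
    unfolding cutoff_def by (simp add: algebra_simps)
  moreover have sub: "tsupp (cutoff S A) \<subseteq> {1 / (2 * A)..1 - 1 / (2 * A)}"
  proof (rule tsupp_subset_closed)
    fix y assume "y \<notin> {1 / (2 * A)..1 - 1 / (2 * A)}"
    then have "A * y \<le> 1/2 \<or> A * (1 - y) \<le> 1/2"
      using \<open>A > 0\<close> by (auto simp: field_simps)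
    then show "cutoff S A y = 0"
      using S unfolding cutoff_def smooth_step_def by auto
  qed simp
  moreover have "{1 / (2 * A)..1 - 1 / (2 * A)} \<subseteq> {0<..<1}"
  proof -
    have "1 / (2 * A) > 0" using \<open>A > 0\<close> by simp
    then show ?thesis
      unfolding subset_iff atLeastAtMost_iff greaterThanLessThan_iff by linarith
  qed
  moreover have "compact (tsupp (cutoff S A))"
    using compact_Icc sub by (rule compact_tsupp)
  ultimately show ?thesis
    unfolding test_function_on_def by blast
qed

lemma cutoff_eq_1:
  assumes "smooth_step S" "A > 0" "1 / A \<le> y" "y \<le> 1 - 1 / A"
  shows "cutoff S A y = 1"
proof -
  have "A * y \<ge> 1" "A * (1 - y) \<ge> 1" using assms by (auto simp: field_simps)
  then show ?thesis using assms unfolding cutoff_def smooth_step_def by auto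
qed

section \<open>The support of a distribution\<close>

lemma test_function_sum:
  assumes "finite I" "\<And>i. i \<in> I \<Longrightarrow> test_function (\<phi> i)"
  shows "test_function (\<lambda>x. \<Sum>i\<in>I. \<phi> i x)"
  using assms
proof (induction I rule: finite_induct)
  case empty
  have "tsupp (\<lambda>x::real. 0::complex) = {}" unfolding tsupp_def by simp
  then show ?case using smooth_on_const unfolding test_function_on_def by simp
next
  case (insert i I)
  then have "test_function (\<lambda>x. \<phi> i x + (\<Sum>i\<in>I. \<phi> i x))"
    by (intro test_function_add) auto
  then show ?case using insert(1,2) by simp
qed

lemma distribution_add:
  "distribution F \<Longrightarrow> test_function \<phi> \<Longrightarrow> test_function \<psi> \<Longrightarrow> F (\<lambda>x. \<phi> x + \<psi> x) = F \<phi> + F \<psi>"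
  unfolding distribution_def by blast

lemma distribution_scale:
  "distribution F \<Longrightarrow> test_function \<phi> \<Longrightarrow> F (\<lambda>x. z * \<phi> x) = z * F \<phi>"
  unfolding distribution_def by blast

lemma distribution_sum:
  assumes F: "distribution F" and "finite I" "\<And>i. i \<in> I \<Longrightarrow> test_function (\<phi> i)"
  shows "F (\<lambda>x. \<Sum>i\<in>I. \<phi> i x) = (\<Sum>i\<in>I. F (\<phi> i))"
  using assms(2,3)
proof (induction I rule: finite_induct)
  case empty
  have "test_function (\<lambda>x. 0)"
    using test_function_sum[of "{}"] by simp
  from distribution_scale[OF F this, of 0] show ?case by simp
next
  case (insert i I)
  have "F (\<lambda>x. \<phi> i x + (\<Sum>i\<in>I. \<phi> i x)) = F (\<phi> i) + F (\<lambda>x. \<Sum>i\<in>I. \<phi> i x)"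
    using insert by (intro distribution_add[OF F] test_function_sum) auto
  then show ?case using insert by simp
qed

lemma test_function_cmult:
  assumes "test_function_on V \<phi>"
  shows "test_function_on V (\<lambda>x. z * \<phi> x :: complex)"
  using test_function_on_mult[OF assms smooth_on_const, of z] by (simp add: mult.commute)

lemma test_function_diff:
  assumes "test_function \<phi>" "test_function \<psi>"
  shows "test_function (\<lambda>x. \<phi> x - \<psi> x)"
  using test_function_add[OF assms(1) test_function_cmult[OF assms(2), of "-1"]] by simp

lemma distribution_diff:
  assumes "distribution F" "test_function \<phi>" "test_function \<psi>"
  shows "F (\<lambda>x. \<phi> x - \<psi> x) = F \<phi> - F \<psi>"
  using distribution_add[OF assms(1,2) test_function_cmult[OF assms(3), of "-1"]]
    distribution_scale[OF assms(1,3), of "-1"] by simp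

text \<open>The definition of the support only says that each point off the support has a neighbourhood
  on which the distribution vanishes. The passage to a whole compact set is by a partition of
  unity whose pieces are shorter than a Lebesgue number of the cover; differences of translated
  steps telescope to such a partition.\<close>

lemma distribution_vanishes_off_support:
  assumes S: "smooth_step S" and F: "distribution F" and \<phi>: "test_function \<phi>"
    and disj: "tsupp \<phi> \<inter> dist_supp F = {}"
  shows "F \<phi> = 0"
proof -
  define \<V> where "\<V> = {V. open V \<and> (\<forall>\<phi>. test_function_on V \<phi> \<longrightarrow> F \<phi> = 0)}"
  have cpt: "compact (tsupp \<phi>)"
    using \<phi> unfolding test_function_on_def by blast
  have cover: "tsupp \<phi> \<subseteq> \<Union>\<V>"
    using disj unfolding dist_supp_def \<V>_def by blast
  show ?thesis
  proof (cases "\<V> = {}")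
    case True
    then have "\<phi> x = 0" for x using cover not_in_tsupp[of x \<phi>] by auto
    then have "\<phi> = (\<lambda>x. 0 * \<phi> x)" by auto
    then show ?thesis using distribution_scale[OF F \<phi>, of 0] by (metis mult_zero_left)
  next
    case False
    obtain \<delta> where \<delta>: "0 < \<delta>" "\<And>T. T \<subseteq> tsupp \<phi> \<Longrightarrow> diameter T < \<delta> \<Longrightarrow> \<exists>V\<in>\<V>. T \<subseteq> V"
      using Lebesgue_number_lemma[OF cpt False cover] unfolding \<V>_def by blast
    obtain B where B: "\<And>x. x \<in> tsupp \<phi> \<Longrightarrow> \<bar>x\<bar> \<le> B"
      using compact_imp_bounded[OF cpt] unfolding bounded_iff by auto
    \<comment> \<open>The pieces of the partition have length \<open>2 * h\<close>. The rescaling \<open>s\<close> maps the support into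
      \<open>[1, n]\<close>, where the first step is completed and the last one has not begun.\<close>
    define h where "h = \<delta> / 4"
    have h: "h > 0" using \<delta>(1) by (simp add: h_def)
    define s where "s x = (x + B) / h + 1" for x
    obtain n :: nat where n: "real n \<ge> 2 * B / h + 1"
      using real_arch_simple by blast
    define \<theta> where "\<theta> j x = complex_of_real (S (s x - real j) - S (s x - real (Suc j)))" for j x
    have aff: "s x - r = (1 / h) * x + (B / h + 1 - r)" for x r
      using h by (simp add: s_def field_simps)
    have \<theta>_smooth: "smooth_on UNIV (\<theta> j)" for j
      unfolding \<theta>_def aff of_real_diff by (intro smooth_on_diff smooth_on_step_affine S)
    have \<theta>_zero: "\<theta> j x = 0" if "x \<notin> {h * (real j - 1) - B .. h * (real j + 1) - B}" for j x
    proof -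
      have "s x < real j \<or> s x > real j + 2"
        using that h by (auto simp: s_def field_simps)
      then show ?thesis
        using S unfolding \<theta>_def smooth_step_def by auto
    qed
    have one: "(\<Sum>j<n. \<theta> j x) = 1" if "x \<in> tsupp \<phi>" for x
    proof -
      have "- B \<le> x" "x \<le> B" using B[OF that] by auto
      then have "s x \<ge> 1" "s x - real n \<le> 0"
        using h n by (auto simp: s_def field_simps)
      then have "S (s x) = 1" "S (s x - real n) = 0"
        using S unfolding smooth_step_def by auto
      moreover have "(\<Sum>j<n. S (s x - real j) - S (s x - real (Suc j))) = S (s x - real 0) - S (s x - real n)"
        by (rule sum_lessThan_telescope')
      ultimately show ?thesis
        unfolding \<theta>_def of_real_sum[symmetric] by simp
    qed
    have piece: "test_function (\<lambda>x. \<phi> x * \<theta> j x)" for j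
      using test_function_on_mult[OF \<phi> \<theta>_smooth] by simp
    have zero: "F (\<lambda>x. \<phi> x * \<theta> j x) = 0" for j
    proof -
      let ?T = "tsupp \<phi> \<inter> {h * (real j - 1) - B .. h * (real j + 1) - B}"
      have sub: "tsupp (\<lambda>x. \<phi> x * \<theta> j x) \<subseteq> ?T"
      proof (rule tsupp_subset_closed)
        show "closed ?T" using cpt by (intro closed_Int compact_imp_closed) auto
        show "\<phi> x * \<theta> j x = 0" if "x \<notin> ?T" for x
          using that not_in_tsupp[of x \<phi>] \<theta>_zero[of x j] by auto
      qed
      have "diameter ?T \<le> 2 * h"
      proof (rule diameter_le)
        show "norm (x - y) \<le> 2 * h" if "x \<in> ?T" "y \<in> ?T" for x y
          using that by (auto simp: algebra_simps)
      qed (use h in auto)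
      then have "diameter ?T < \<delta>" using h by (simp add: h_def)
      then obtain V where "V \<in> \<V>" "?T \<subseteq> V" using \<delta>(2)[of ?T] by blast
      then show ?thesis
        using test_function_on_subset[OF piece, of j V] sub unfolding \<V>_def by auto
    qed
    have "\<phi> = (\<lambda>x. \<Sum>j<n. \<phi> x * \<theta> j x)"
    proof
      show "\<phi> x = (\<Sum>j<n. \<phi> x * \<theta> j x)" for x
        using one[of x] not_in_tsupp[of x \<phi>]
        by (cases "x \<in> tsupp \<phi>") (auto simp: sum_distrib_left[symmetric])
    qed
    then have "F \<phi> = F (\<lambda>x. \<Sum>j<n. \<phi> x * \<theta> j x)" by simp
    also have "\<dots> = (\<Sum>j<n. F (\<lambda>x. \<phi> x * \<theta> j x))"
      using piece by (intro distribution_sum F) auto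
    finally show ?thesis using zero by simp
  qed
qed

lemma distribution_eq_near_support:
  assumes S: "smooth_step S" and F: "distribution F"
    and "test_function \<phi>" "test_function \<psi>"
    and W: "open W" "dist_supp F \<subseteq> W" "\<And>y. y \<in> W \<Longrightarrow> \<phi> y = \<psi> y"
  shows "F \<phi> = F \<psi>"
proof -
  have "tsupp (\<lambda>x. \<phi> x - \<psi> x) \<subseteq> - W"
    using W by (intro tsupp_subset_closed) auto
  then have "F (\<lambda>x. \<phi> x - \<psi> x) = 0"
    using W(2) assms(3,4) by (intro distribution_vanishes_off_support[OF S F] test_function_diff) auto
  then show ?thesis
    using distribution_diff[OF F assms(3,4)] by simp
qed

text \<open>The pairing may be computed with any one cutoff, and with any globally smooth function that
  agrees on \<open>V\<close> with the given one.\<close>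

lemma ext_pairing_eq:
  assumes S: "smooth_step S" and F: "distribution F"
    and \<eta>: "test_function_on V \<eta>" and W: "open W" "dist_supp F \<subseteq> W" "\<And>y. y \<in> W \<Longrightarrow> \<eta> y = 1"
    and g: "smooth_on UNIV g" "\<And>y. y \<in> V \<Longrightarrow> g' y = g y"
  shows "ext_pairing V F g' = F (\<lambda>y. \<eta> y * g y)"
proof -
  have eq: "(\<lambda>y. \<theta> y * g' y) = (\<lambda>y. \<theta> y * g y)" if "test_function_on V \<theta>" for \<theta> :: "real \<Rightarrow> complex"
  proof
    fix y
    show "\<theta> y * g' y = \<theta> y * g y"
      using that g(2)[of y] not_in_tsupp[of y \<theta>] unfolding test_function_on_def by auto
  qed
  have "F (\<lambda>y. \<theta> y * g' y) = F (\<lambda>y. \<eta> y * g y)"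
    if \<theta>: "test_function_on V \<theta>" and W': "open W'" "dist_supp F \<subseteq> W'" "\<forall>y\<in>W'. \<theta> y = 1" for \<theta> W'
  proof -
    have "F (\<lambda>y. \<theta> y * g y) = F (\<lambda>y. \<eta> y * g y)"
    proof (rule distribution_eq_near_support[OF S F])
      show "open (W \<inter> W')" "dist_supp F \<subseteq> W \<inter> W'" using W W' by auto
      show "\<theta> y * g y = \<eta> y * g y" if "y \<in> W \<inter> W'" for y using that W W' by auto
    qed (auto intro: test_function_on_imp_test_function test_function_on_mult \<eta> \<theta> g)
    then show ?thesis by (simp add: eq[OF \<theta>])
  qed
  moreover have "F (\<lambda>y. \<eta> y * g' y) = F (\<lambda>y. \<eta> y * g y)"
    by (simp add: eq[OF \<eta>])
  ultimately show ?thesis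
    unfolding ext_pairing_def using \<eta> W by (intro the_equality) metis+
qed

lemma real_valued_distribution_cnj:
  assumes F: "real_valued_distribution F" and \<phi>: "test_function \<phi>"
  shows "F (\<lambda>x. cnj (\<phi> x)) = cnj (F \<phi>)"
proof -
  define p where "p = (\<lambda>x. complex_of_real (Re (\<phi> x)))"
  define q where "q = (\<lambda>x. complex_of_real (Im (\<phi> x)))"
  have sm: "smooth_on UNIV \<phi>" using \<phi> unfolding test_function_on_def by blast
  have p: "test_function p"
    unfolding p_def
    by (rule test_function_on_shrink[OF \<phi>],
        rule smooth_on_linear_image[OF bounded_linear_of_real smooth_on_linear_image[OF bounded_linear_Re sm]]) simp
  have q: "test_function q"
    unfolding q_def
    by (rule test_function_on_shrink[OF \<phi>],
        rule smooth_on_linear_image[OF bounded_linear_of_real smooth_on_linear_image[OF bounded_linear_Im sm]]) simp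
  have dist: "distribution F" and re: "F p \<in> \<real>" "F q \<in> \<real>"
    using F p q unfolding real_valued_distribution_def p_def q_def by auto
  have 1: "\<phi> = (\<lambda>x. p x + \<i> * q x)"
    unfolding p_def q_def by (auto simp: complex_eq_iff)
  have 2: "(\<lambda>x. cnj (\<phi> x)) = (\<lambda>x. p x + (- \<i>) * q x)"
    unfolding p_def q_def by (auto simp: complex_eq_iff)
  have "F \<phi> = F p + \<i> * F q"
    by (subst 1) (simp only: distribution_add[OF dist p test_function_cmult[OF q]] distribution_scale[OF dist q])
  moreover have "F (\<lambda>x. cnj (\<phi> x)) = F p + (- \<i>) * F q"
    by (subst 2) (simp only: distribution_add[OF dist p test_function_cmult[OF q]] distribution_scale[OF dist q])
  ultimately show ?thesis
    using re by (simp add: Reals_cnj_iff)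
qed

section \<open>Gaussian fields have a uniform support\<close>

lemma compact_subset_unit_interval:
  assumes "compact L" "L \<subseteq> {0<..<1::real}"
  obtains A0 where "A0 > 0" "\<And>A. A > A0 \<Longrightarrow> L \<subseteq> {1 / A<..<1 - 1 / A}"
proof (cases "L = {}")
  case True
  then show ?thesis using that[of 1] by simp
next
  case False
  obtain l u where lu: "l \<in> L" "u \<in> L" "\<And>x. x \<in> L \<Longrightarrow> l \<le> x \<and> x \<le> u"
    using compact_attains_inf[OF assms(1) False] compact_attains_sup[OF assms(1) False] by metis
  then have "0 < l" "u < 1" using assms(2) by auto
  show ?thesis
  proof (rule that[of "max (1 / l) (1 / (1 - u))"])
    show "max (1 / l) (1 / (1 - u)) > 0" using \<open>0 < l\<close> by (simp add: less_max_iff_disj)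
    fix A assume A: "A > max (1 / l) (1 / (1 - u))"
    then have "A > 0" using \<open>0 < l\<close> by (smt (verit) zero_less_divide_1_iff)
    then have "1 / A < l" "u < 1 - 1 / A"
      using A \<open>0 < l\<close> \<open>u < 1\<close> by (auto simp: field_simps)
    then show "L \<subseteq> {1 / A<..<1 - 1 / A}" using lu(3) by force
  qed
qed

lemma gaussian_rv_zero_dichotomy:
  assumes "gaussian_rv M X"
  shows "(AE \<omega> in M. X \<omega> \<noteq> 0) \<or> (\<exists>a. AE \<omega> in M. X \<omega> = a)"
proof -
  have "AE \<omega> in M. X \<omega> \<noteq> 0" if "distributed M lborel X d" for d
  proof -
    have X: "X \<in> measurable M lborel" and [measurable]: "d \<in> borel_measurable lborel"
      and d: "distr M lborel X = density lborel d"
      using that unfolding distributed_def by auto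
    have "AE t in lborel. t \<noteq> (0::real)" by (rule AE_lborel_singleton)
    then have "AE t in density lborel d. t \<noteq> 0"
      by (subst AE_density) auto
    then show ?thesis
      unfolding d[symmetric] by (subst (asm) AE_distr_iff) (use X in auto)
  qed
  then show ?thesis using assms unfolding gaussian_rv_def by blast
qed


text \<open>If the field were nondegenerate arbitrarily near the boundary of the interval, it would be
  almost surely nonzero on each member of a sequence of test functions that escape to the
  boundary; but every realization has compact support and thus kills all but finitely many of
  them. The pairing of a centered Gaussian field with a real test function is either almost surely
  zero or almost surely nonzero, so no independence is needed.\<close>

lemma gaussian_field_uniform_support:
  assumes M: "prob_space M" and S: "smooth_step S"
    and f: "\<And>\<omega>. \<omega> \<in> space M \<Longrightarrow> real_valued_distribution (f \<omega>)"
    and supp: "\<And>\<omega>. \<omega> \<in> space M \<Longrightarrow> compact (dist_supp (f \<omega>)) \<and> dist_supp (f \<omega>) \<subseteq> {0<..<1}"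
    and gauss: "gaussian_field M f" and cent: "centered M f"
  shows "\<exists>A0>0. \<forall>\<phi>. test_function \<phi> \<longrightarrow> tsupp \<phi> \<inter> {1 / A0..1 - 1 / A0} = {} \<longrightarrow>
    (AE \<omega> in M. f \<omega> \<phi> = 0)"
proof (rule ccontr)
  interpret prob_space M by fact
  assume contra: "\<not> ?thesis"
  have "\<exists>\<phi>. test_function \<phi> \<and> tsupp \<phi> \<inter> {1 / Suc n..1 - 1 / Suc n} = {} \<and>
    (AE \<omega> in M. f \<omega> \<phi> \<noteq> 0)" for n
  proof -
    obtain \<phi> where \<phi>: "test_function \<phi>" "tsupp \<phi> \<inter> {1 / Suc n..1 - 1 / Suc n} = {}"
      and nz: "\<not> (AE \<omega> in M. f \<omega> \<phi> = 0)"
      using contra of_nat_0_less_iff zero_less_Suc by meson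
    have sm: "smooth_on UNIV \<phi>" using \<phi> unfolding test_function_on_def by blast
    define p where "p = (\<lambda>x. complex_of_real (Re (\<phi> x)))"
    define q where "q = (\<lambda>x. complex_of_real (Im (\<phi> x)))"
    have p: "test_function p"
      unfolding p_def
      by (rule test_function_on_shrink[OF \<phi>(1)],
          rule smooth_on_linear_image[OF bounded_linear_of_real smooth_on_linear_image[OF bounded_linear_Re sm]]) simp
    have q: "test_function q"
      unfolding q_def
      by (rule test_function_on_shrink[OF \<phi>(1)],
          rule smooth_on_linear_image[OF bounded_linear_of_real smooth_on_linear_image[OF bounded_linear_Im sm]]) simp
    have real: "\<forall>x. p x \<in> \<real>" "\<forall>x. q x \<in> \<real>" unfolding p_def q_def by auto
    have sub: "tsupp p \<subseteq> tsupp \<phi>" "tsupp q \<subseteq> tsupp \<phi>"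
      unfolding p_def q_def by (rule tsupp_mono, simp)+
    have dicho: "(AE \<omega> in M. f \<omega> r \<noteq> 0) \<or> (AE \<omega> in M. f \<omega> r = 0)"
      if r: "test_function r" "\<forall>x. r x \<in> \<real>" for r
    proof -
      have re: "f \<omega> r = complex_of_real (Re (f \<omega> r))" if "\<omega> \<in> space M" for \<omega>
        using f[OF that] r unfolding real_valued_distribution_def by simp
      have "gaussian_rv M (\<lambda>\<omega>. Re (f \<omega> r))"
        using gauss r unfolding gaussian_field_def by blast
      then consider "AE \<omega> in M. Re (f \<omega> r) \<noteq> 0" | a where "AE \<omega> in M. Re (f \<omega> r) = a"
        using gaussian_rv_zero_dichotomy by blast
      then show ?thesis
      proof cases
        case 1
        then have "AE \<omega> in M. f \<omega> r \<noteq> 0" by eventually_elim auto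
        then show ?thesis by blast
      next
        case 2
        have ae: "AE \<omega> in M. f \<omega> r = complex_of_real a"
          using 2 AE_space
        proof eventually_elim
          case (elim \<omega>)
          then show ?case using re[of \<omega>] by simp
        qed
        have "mean_dist M f r = 0" using cent r unfolding centered_def by blast
        moreover have "mean_dist M f r = (\<integral>\<omega>. complex_of_real a \<partial>M)"
        proof -
          have [measurable]: "(\<lambda>\<omega>. Re (f \<omega> r)) \<in> borel_measurable M"
            using \<open>gaussian_rv M (\<lambda>\<omega>. Re (f \<omega> r))\<close> unfolding gaussian_rv_def by blast
          have "(\<lambda>\<omega>. f \<omega> r) \<in> borel_measurable M"
            by (subst measurable_cong[OF re]) auto
          then show ?thesis
            unfolding mean_dist_def using ae by (intro integral_cong_AE) auto
        qed
        ultimately have "a = 0" by (simp add: prob_space)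
        then show ?thesis using ae by simp
      qed
    qed
    have split: "f \<omega> \<phi> = f \<omega> p + \<i> * f \<omega> q" if "\<omega> \<in> space M" for \<omega>
    proof -
      have dist: "distribution (f \<omega>)" using f[OF that] unfolding real_valued_distribution_def by blast
      have "\<phi> = (\<lambda>x. p x + \<i> * q x)"
        unfolding p_def q_def by (auto simp: complex_eq_iff)
      then show ?thesis
        using distribution_add[OF dist p test_function_cmult[OF q, of \<i>]] distribution_scale[OF dist q, of \<i>]
        by simp
    qed
    have "\<not> ((AE \<omega> in M. f \<omega> p = 0) \<and> (AE \<omega> in M. f \<omega> q = 0))"
    proof
      assume "(AE \<omega> in M. f \<omega> p = 0) \<and> (AE \<omega> in M. f \<omega> q = 0)"
      then have "AE \<omega> in M. f \<omega> p = 0" "AE \<omega> in M. f \<omega> q = 0" by auto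
      then have "AE \<omega> in M. f \<omega> \<phi> = 0"
        using AE_space by eventually_elim (simp add: split)
      then show False using nz by blast
    qed
    then have "(AE \<omega> in M. f \<omega> p \<noteq> 0) \<or> (AE \<omega> in M. f \<omega> q \<noteq> 0)"
      using dicho[OF p real(1)] dicho[OF q real(2)] by blast
    then show ?thesis
      using p q sub \<phi>(2) by (metis (no_types, lifting) disjoint_iff subsetD)
  qed
  then obtain \<phi> where \<phi>: "\<And>n. test_function (\<phi> n)"
    "\<And>n. tsupp (\<phi> n) \<inter> {1 / Suc n..1 - 1 / Suc n} = {}" "\<And>n. AE \<omega> in M. f \<omega> (\<phi> n) \<noteq> 0"
    by metis
  have "AE \<omega> in M. \<forall>n. f \<omega> (\<phi> n) \<noteq> 0" using \<phi>(3) by (simp add: AE_all_countable)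
  then have "AE \<omega> in M. False"
    using AE_space
  proof eventually_elim
    case (elim \<omega>)
    obtain A0 where A0: "A0 > 0" "\<And>A. A > A0 \<Longrightarrow> dist_supp (f \<omega>) \<subseteq> {1 / A<..<1 - 1 / A}"
      using compact_subset_unit_interval supp[OF elim(2)] by blast
    obtain n where "A0 < real (Suc n)" using reals_Archimedean2 by (metis less_Suc_eq of_nat_less_iff order_less_trans)
    then have "dist_supp (f \<omega>) \<subseteq> {1 / real (Suc n)..1 - 1 / real (Suc n)}"
      using A0(2)[of "real (Suc n)"] by fastforce
    then have "f \<omega> (\<phi> n) = 0"
      using \<phi>(1,2)[of n] f[OF elim(2)] unfolding real_valued_distribution_def
      by (intro distribution_vanishes_off_support[OF S]) auto
    then show False using elim(1) by blast
  qed
  then show False using AE_False by simp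
qed

lemma test_function_cutoff_mult:
  assumes "smooth_step S" "A > 0" "smooth_on UNIV g"
  shows "test_function (\<lambda>y. cutoff S A y * g y)"
  using test_function_on_mult[OF test_function_cutoff[OF assms(1,2)] assms(3)]
  by (rule test_function_on_imp_test_function)

text \<open>Each realization needs its own cutoff, but these cutoffs may be taken from one sequence.
  This gives measurability of the pairing, and by the uniform support a single cutoff serves
  almost every realization.\<close>

lemma ext_pairing_random:
  fixes g g' :: "real \<Rightarrow> complex"
  assumes S: "smooth_step S" and A0: "A0 > 0" "A > A0"
    and unif: "\<And>\<phi>. test_function \<phi> \<Longrightarrow> tsupp \<phi> \<inter> {1 / A0..1 - 1 / A0} = {} \<Longrightarrow> AE \<omega> in M. f \<omega> \<phi> = 0"
    and f: "random_distribution M f"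
    and supp: "\<And>\<omega>. \<omega> \<in> space M \<Longrightarrow> compact (dist_supp (f \<omega>)) \<and> dist_supp (f \<omega>) \<subseteq> {0<..<1}"
    and g: "smooth_on UNIV g" "\<And>y. y \<in> {0<..<1} \<Longrightarrow> g' y = g y"
  shows "(\<lambda>\<omega>. ext_pairing {0<..<1} (f \<omega>) g') \<in> borel_measurable M"
    and "AE \<omega> in M. ext_pairing {0<..<1} (f \<omega>) g' = f \<omega> (\<lambda>y. cutoff S A y * g y)"
proof -
  have dist: "distribution (f \<omega>)" if "\<omega> \<in> space M" for \<omega>
    using f that unfolding random_distribution_def by blast
  have eventually_eq: "\<forall>\<^sub>F n in sequentially. A < real (Suc n) \<and>
      ext_pairing {0<..<1} (f \<omega>) g' = f \<omega> (\<lambda>y. cutoff S (Suc n) y * g y)"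
    if \<omega>: "\<omega> \<in> space M" for \<omega>
  proof -
    obtain B where B: "B > 0" "\<And>A. A > B \<Longrightarrow> dist_supp (f \<omega>) \<subseteq> {1 / A<..<1 - 1 / A}"
      using compact_subset_unit_interval supp[OF \<omega>] by blast
    have "\<forall>\<^sub>F n in sequentially. max A B < real (Suc n)"
      using eventually_gt_at_top[of "nat \<lceil>max A B\<rceil>"] by eventually_elim linarith
    then show ?thesis
    proof eventually_elim
      case (elim n)
      have "ext_pairing {0<..<1} (f \<omega>) g' = f \<omega> (\<lambda>y. cutoff S (Suc n) y * g y)"
      proof (rule ext_pairing_eq[OF S dist[OF \<omega>] test_function_cutoff[OF S], rotated])
        show "dist_supp (f \<omega>) \<subseteq> {1 / real (Suc n)<..<1 - 1 / real (Suc n)}"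
          using B elim by simp
        show "cutoff S (Suc n) y = 1" if "y \<in> {1 / real (Suc n)<..<1 - 1 / real (Suc n)}" for y
          using that by (intro cutoff_eq_1[OF S]) auto
      qed (use g in auto)
      then show ?case using elim by simp
    qed
  qed
  show "(\<lambda>\<omega>. ext_pairing {0<..<1} (f \<omega>) g') \<in> borel_measurable M"
  proof (rule borel_measurable_LIMSEQ_metric)
    show "(\<lambda>\<omega>. f \<omega> (\<lambda>y. cutoff S (Suc n) y * g y)) \<in> borel_measurable M" for n
      using f test_function_cutoff_mult[OF S _ g(1), of "Suc n"] unfolding random_distribution_def by simp
    show "(\<lambda>n. f \<omega> (\<lambda>y. cutoff S (Suc n) y * g y)) \<longlonglongrightarrow> ext_pairing {0<..<1} (f \<omega>) g'"
      if "\<omega> \<in> space M" for \<omega>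
      using eventually_eq[OF that] by (intro tendsto_eventually) (auto elim: eventually_mono)
  qed
  have "AE \<omega> in M. real (Suc n) > A \<longrightarrow>
      f \<omega> (\<lambda>y. cutoff S (Suc n) y * g y) = f \<omega> (\<lambda>y. cutoff S A y * g y)" for n
  proof (cases "real (Suc n) > A")
    case True
    let ?\<phi> = "\<lambda>y. cutoff S (Suc n) y * g y" and ?\<psi> = "\<lambda>y. cutoff S A y * g y"
    have tf: "test_function ?\<phi>" "test_function ?\<psi>"
      using True A0 by (auto intro!: test_function_cutoff_mult S g)
    have "tsupp (\<lambda>y. ?\<phi> y - ?\<psi> y) \<subseteq> - {1 / A<..<1 - 1 / A}"
    proof (rule tsupp_subset_closed)
      fix y assume "y \<notin> - {1 / A<..<1 - 1 / A}"
      then have y: "1 / A \<le> y" "y \<le> 1 - 1 / A" by auto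
      moreover have "1 / real (Suc n) \<le> 1 / A" using True A0 by (intro divide_left_mono) auto
      ultimately have "cutoff S (Suc n) y = 1" "cutoff S A y = 1"
        using True A0 by (auto intro!: cutoff_eq_1[OF S])
      then show "?\<phi> y - ?\<psi> y = 0" by simp
    qed auto
    moreover have "1 / A < 1 / A0" using A0 by (simp add: divide_strict_left_mono)
    ultimately have "tsupp (\<lambda>y. ?\<phi> y - ?\<psi> y) \<inter> {1 / A0..1 - 1 / A0} = {}"
      by force
    then have "AE \<omega> in M. f \<omega> (\<lambda>y. ?\<phi> y - ?\<psi> y) = 0"
      by (intro unif test_function_diff tf)
    then show ?thesis
      using AE_space
    proof eventually_elim
      case (elim \<omega>)
      then show ?case using distribution_diff[OF dist[OF elim(2)] tf] by simp
    qed
  qed simp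
  then have "AE \<omega> in M. \<forall>n. real (Suc n) > A \<longrightarrow>
      f \<omega> (\<lambda>y. cutoff S (Suc n) y * g y) = f \<omega> (\<lambda>y. cutoff S A y * g y)"
    by (subst AE_all_countable) blast
  then show "AE \<omega> in M. ext_pairing {0<..<1} (f \<omega>) g' = f \<omega> (\<lambda>y. cutoff S A y * g y)"
    using AE_space
  proof eventually_elim
    case (elim \<omega>)
    then obtain n where "A < real (Suc n)"
      "ext_pairing {0<..<1} (f \<omega>) g' = f \<omega> (\<lambda>y. cutoff S (Suc n) y * g y)"
      using eventually_happens[OF eventually_eq[OF elim(2)]] by auto
    then show ?case using elim(1) by metis
  qed
qed

section \<open>The Fourier-Laplace transform of a test function\<close>

lemma test_function_derivative:
  assumes \<phi>: "test_function_on V \<phi>"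
  shows "\<exists>\<phi>'. test_function_on V \<phi>' \<and> (\<forall>x. (\<phi> has_vector_derivative \<phi>' x) (at x))"
proof -
  have "smooth_on UNIV \<phi>" using \<phi> unfolding test_function_on_def by blast
  then obtain \<phi>' where d: "smooth_on UNIV \<phi>'" "\<And>x. (\<phi> has_vector_derivative \<phi>' x) (at x)"
    using smooth_on_derivative by blast
  have "tsupp \<phi>' \<subseteq> tsupp \<phi>"
  proof (rule tsupp_subset_closed)
    show "closed (tsupp \<phi>)" unfolding tsupp_def by (rule closed_closure)
    fix x assume x: "x \<notin> tsupp \<phi>"
    have "(\<phi> has_vector_derivative 0) (at x)"
    proof (rule has_vector_derivative_transform_within_open[of "\<lambda>_. 0" _ _ "- tsupp \<phi>"])
      show "open (- tsupp \<phi>)" unfolding tsupp_def by (intro open_Compl closed_closure)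
      show "0 = \<phi> y" if "y \<in> - tsupp \<phi>" for y using that not_in_tsupp[of y \<phi>] by simp
    qed (use x in auto)
    from vector_derivative_unique_at[OF d(2) this] show "\<phi>' x = 0" .
  qed
  moreover from this have "compact (tsupp \<phi>')"
    using \<phi> compact_tsupp[of "tsupp \<phi>" \<phi>'] unfolding test_function_on_def by blast
  ultimately have "test_function_on V \<phi>'"
    using \<phi> d(1) unfolding test_function_on_def by auto
  then show ?thesis using d(2) by blast
qed

lemma test_function_bounded_support:
  assumes "test_function_on V \<phi>"
  obtains B where "B > 0" "\<And>x. x \<notin> {-B<..<B} \<Longrightarrow> \<phi> x = 0"
proof -
  have "bounded (tsupp \<phi>)"
    using assms compact_imp_bounded unfolding test_function_on_def by blast
  then obtain B where B: "B > 0" "\<forall>x\<in>tsupp \<phi>. norm x < B"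
    unfolding bounded_pos_less by blast
  show ?thesis
  proof (rule that[OF B(1)])
    fix x assume "x \<notin> {-B<..<B}"
    then have "x \<notin> tsupp \<phi>" using B(2) by (auto simp: abs_less_iff)
    then show "\<phi> x = 0" by (rule not_in_tsupp)
  qed
qed

lemma integrable_bounded_support:
  fixes g :: "real \<Rightarrow> 'b::{banach, second_countable_topology}"
  assumes "continuous_on UNIV g" and "\<And>x. x \<notin> {-B<..<B} \<Longrightarrow> g x = 0"
  shows "integrable lborel g"
proof -
  have "set_integrable lborel {-B..B} g"
    by (rule borel_integrable_atLeastAtMost') (rule continuous_on_subset[OF assms(1)], simp)
  moreover have "(\<lambda>x. indicator {-B..B} x *\<^sub>R g x) = g"
    using assms(2) by (fastforce simp: indicator_def)
  ultimately show ?thesis unfolding set_integrable_def by simp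
qed

lemma integrable_mult_test_function:
  fixes \<phi> v :: "real \<Rightarrow> 'b::{banach, second_countable_topology, real_normed_algebra}"
  assumes \<phi>: "test_function_on V \<phi>" and v: "continuous_on UNIV v"
  shows "integrable lborel (\<lambda>x. v x * \<phi> x)"
proof -
  obtain B where "B > 0" "\<And>x. x \<notin> {-B<..<B} \<Longrightarrow> \<phi> x = 0"
    using test_function_bounded_support[OF \<phi>] by blast
  moreover have "continuous_on UNIV \<phi>"
    using \<phi> smooth_on_continuous unfolding test_function_on_def by blast
  ultimately show ?thesis
    using v by (intro integrable_bounded_support[where B = B] continuous_intros) auto
qed

lemma integral_derivative_test_function:
  fixes \<phi> :: "real \<Rightarrow> complex"
  assumes \<phi>: "test_function \<phi>" and d: "\<And>x. (\<phi> has_vector_derivative \<phi>' x) (at x)"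
  shows "(\<integral>x. \<phi>' x \<partial>lborel) = 0"
proof -
  obtain \<psi> where \<psi>: "test_function \<psi>" "\<forall>x. (\<phi> has_vector_derivative \<psi> x) (at x)"
    using test_function_derivative[OF \<phi>] by blast
  have eq: "\<phi>' = \<psi>"
    using vector_derivative_unique_at[OF d] \<psi>(2) by blast
  obtain B where B: "B > 0" "\<And>x. x \<notin> {-B<..<B} \<Longrightarrow> \<phi> x = 0"
    using test_function_bounded_support[OF \<phi>] by blast
  obtain C where C: "C > 0" "\<And>x. x \<notin> {-C<..<C} \<Longrightarrow> \<psi> x = 0"
    using test_function_bounded_support[OF \<psi>(1)] by blast
  let ?R = "max B C"
  have "continuous_on {-?R..?R} \<psi>"
    using \<psi>(1) smooth_on_continuous unfolding test_function_on_def by blast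
  then have "(\<integral>x. indicator {-?R..?R} x *\<^sub>R \<psi> x \<partial>lborel) = \<phi> ?R - \<phi> (- ?R)"
    using B(1) \<psi>(2) by (intro integral_FTC_atLeastAtMost) (auto intro: has_vector_derivative_at_within)
  also have "\<dots> = 0" using B(2)[of ?R] B(2)[of "- ?R"] by simp
  also have "(\<lambda>x. indicator {-?R..?R} x *\<^sub>R \<psi> x) = \<psi>"
  proof
    fix x show "indicator {-?R..?R} x *\<^sub>R \<psi> x = \<psi> x"
    proof (cases "x \<in> {-?R..?R}")
      case False
      then have "x \<notin> {-C<..<C}" by auto
      then show ?thesis using C(2)[of x] by simp
    qed simp
  qed
  finally show ?thesis by (simp add: eq)
qed

definition fourier_laplace :: "(real \<Rightarrow> complex) \<Rightarrow> complex \<Rightarrow> complex" where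
  "fourier_laplace \<phi> \<zeta> = (\<integral>y. exp (- \<i> * \<zeta> * of_real y) * \<phi> y \<partial>lborel)"

lemma fourier_laplace_derivative:
  assumes \<phi>: "test_function \<phi>" and \<phi>': "test_function \<phi>'"
    and d: "\<And>x. (\<phi> has_vector_derivative \<phi>' x) (at x)"
  shows "fourier_laplace \<phi>' \<zeta> = \<i> * \<zeta> * fourier_laplace \<phi> \<zeta>"
proof -
  let ?e = "\<lambda>y. exp (- \<i> * \<zeta> * complex_of_real y)"
  have sm: "smooth_on UNIV ?e" by (rule smooth_on_exp)
  have int: "integrable lborel (\<lambda>y. ?e y * \<phi> y)" "integrable lborel (\<lambda>y. ?e y * \<phi>' y)"
    by (auto intro!: integrable_mult_test_function[OF \<phi>] integrable_mult_test_function[OF \<phi>'] continuous_intros)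
  have "test_function (\<lambda>y. ?e y * \<phi> y)"
    using test_function_on_mult[OF \<phi> sm] by (simp add: mult.commute)
  moreover have "((\<lambda>y. ?e y * \<phi> y) has_vector_derivative
      (?e x * \<phi>' x + (- \<i> * \<zeta> * ?e x) * \<phi> x)) (at x)" for x
  proof (rule has_vector_derivative_mult[OF _ d])
    show "(?e has_vector_derivative (- \<i> * \<zeta> * ?e x)) (at x)"
      by (rule has_vector_derivative_real_field) (auto intro!: derivative_eq_intros)
  qed
  ultimately have "(\<integral>x. ?e x * \<phi>' x + (- \<i> * \<zeta> * ?e x) * \<phi> x \<partial>lborel) = 0"
    by (rule integral_derivative_test_function)
  moreover have "(\<integral>x. ?e x * \<phi>' x + (- \<i> * \<zeta>) * (?e x * \<phi> x) \<partial>lborel) =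
      fourier_laplace \<phi>' \<zeta> + (- \<i> * \<zeta>) * fourier_laplace \<phi> \<zeta>"
    unfolding fourier_laplace_def
    by (subst Bochner_Integration.integral_add) (use int in \<open>auto simp only: integral_mult_right_zero integrable_mult_right\<close>)
  ultimately show ?thesis by (simp add: mult.assoc)
qed

text \<open>Paley-Wiener: multiplication by \<open>\<i>\<zeta>\<close> is differentiation of the test function, so
  each power of \<open>\<zeta>\<close> is absorbed by passing to the derivative; on a horizontal strip the
  exponential stays bounded on the support.\<close>

lemma fourier_laplace_power_bound:
  assumes "test_function \<phi>"
  shows "\<exists>C. \<forall>\<zeta>. \<bar>Im \<zeta>\<bar> \<le> B \<longrightarrow> norm \<zeta> ^ n * norm (fourier_laplace \<phi> \<zeta>) \<le> C"
  using assms
proof (induction n arbitrary: \<phi>)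
  case 0
  have int: "integrable lborel (\<lambda>y. complex_of_real (exp (B * \<bar>y\<bar>)) * \<phi> y)"
    by (intro integrable_mult_test_function[OF 0] continuous_intros)
  show ?case
  proof (intro exI allI impI)
    fix \<zeta> :: complex assume \<zeta>: "\<bar>Im \<zeta>\<bar> \<le> B"
    have "norm (fourier_laplace \<phi> \<zeta>) \<le> (\<integral>y. norm (complex_of_real (exp (B * \<bar>y\<bar>)) * \<phi> y) \<partial>lborel)"
      unfolding fourier_laplace_def
    proof (rule order_trans[OF integral_norm_bound], rule integral_mono)
      show "integrable lborel (\<lambda>y. norm (exp (- \<i> * \<zeta> * complex_of_real y) * \<phi> y))"
        by (intro integrable_norm integrable_mult_test_function[OF 0] continuous_intros)
      show "integrable lborel (\<lambda>y. norm (complex_of_real (exp (B * \<bar>y\<bar>)) * \<phi> y))"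
        by (intro integrable_norm int)
      fix y
      have "Im \<zeta> * y \<le> \<bar>Im \<zeta>\<bar> * \<bar>y\<bar>" by (metis abs_ge_self abs_mult)
      also have "\<dots> \<le> B * \<bar>y\<bar>" using \<zeta> by (intro mult_right_mono) auto
      finally show "norm (exp (- \<i> * \<zeta> * complex_of_real y) * \<phi> y) \<le> norm (complex_of_real (exp (B * \<bar>y\<bar>)) * \<phi> y)"
        by (auto simp: norm_mult intro!: mult_right_mono)
    qed
    then show "norm \<zeta> ^ 0 * norm (fourier_laplace \<phi> \<zeta>) \<le>
        (\<integral>y. norm (complex_of_real (exp (B * \<bar>y\<bar>)) * \<phi> y) \<partial>lborel)"
      by simp
  qed
next
  case (Suc n)
  obtain \<phi>' where \<phi>': "test_function \<phi>'" "\<forall>x. (\<phi> has_vector_derivative \<phi>' x) (at x)"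
    using test_function_derivative[OF Suc.prems] by blast
  obtain C where C: "\<forall>\<zeta>. \<bar>Im \<zeta>\<bar> \<le> B \<longrightarrow> norm \<zeta> ^ n * norm (fourier_laplace \<phi>' \<zeta>) \<le> C"
    using Suc.IH[OF \<phi>'(1)] by blast
  have eq: "norm (fourier_laplace \<phi>' \<zeta>) = norm \<zeta> * norm (fourier_laplace \<phi> \<zeta>)" for \<zeta>
    using fourier_laplace_derivative[OF Suc.prems \<phi>'(1)] \<phi>'(2) by (simp add: norm_mult)
  show ?case using C unfolding eq by (auto intro!: exI[of _ C] simp: mult_ac)
qed

lemma fourier_laplace_decay:
  assumes "test_function \<phi>"
  shows "\<exists>C. \<forall>\<zeta>. \<bar>Im \<zeta>\<bar> \<le> B \<longrightarrow> (1 + \<bar>Re \<zeta>\<bar>) ^ n * norm (fourier_laplace \<phi> \<zeta>) \<le> C"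
proof -
  obtain C0 Cn where C: "\<forall>\<zeta>. \<bar>Im \<zeta>\<bar> \<le> B \<longrightarrow> norm \<zeta> ^ 0 * norm (fourier_laplace \<phi> \<zeta>) \<le> C0"
    "\<forall>\<zeta>. \<bar>Im \<zeta>\<bar> \<le> B \<longrightarrow> norm \<zeta> ^ n * norm (fourier_laplace \<phi> \<zeta>) \<le> Cn"
    using fourier_laplace_power_bound[OF assms] by blast
  have "(1 + \<bar>Re \<zeta>\<bar>) ^ n * norm (fourier_laplace \<phi> \<zeta>) \<le> 2 ^ n * (C0 + Cn)" if "\<bar>Im \<zeta>\<bar> \<le> B" for \<zeta>
  proof -
    have "(1 + \<bar>Re \<zeta>\<bar>) ^ n \<le> 2 ^ n * (1 + norm \<zeta> ^ n)"
    proof (cases "\<bar>Re \<zeta>\<bar> \<le> 1")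
      case True
      then have "(1 + \<bar>Re \<zeta>\<bar>) ^ n \<le> 2 ^ n * 1" by (simp add: power_mono)
      also have "\<dots> \<le> 2 ^ n * (1 + norm \<zeta> ^ n)" by (intro mult_left_mono) auto
      finally show ?thesis .
    next
      case False
      then have "(1 + \<bar>Re \<zeta>\<bar>) ^ n \<le> (2 * norm \<zeta>) ^ n"
        using abs_Re_le_cmod[of \<zeta>] by (intro power_mono) auto
      also have "\<dots> \<le> 2 ^ n * (1 + norm \<zeta> ^ n)" by (simp add: power_mult_distrib)
      finally show ?thesis .
    qed
    then have "(1 + \<bar>Re \<zeta>\<bar>) ^ n * norm (fourier_laplace \<phi> \<zeta>) \<le>
        2 ^ n * (1 + norm \<zeta> ^ n) * norm (fourier_laplace \<phi> \<zeta>)"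
      by (rule mult_right_mono) simp
    also have "\<dots> = 2 ^ n * (norm \<zeta> ^ 0 * norm (fourier_laplace \<phi> \<zeta>) + norm \<zeta> ^ n * norm (fourier_laplace \<phi> \<zeta>))"
      by (simp add: algebra_simps)
    also have "\<dots> \<le> 2 ^ n * (C0 + Cn)"
      using C that by (intro mult_left_mono add_mono) auto
    finally show ?thesis .
  qed
  then show ?thesis by blast
qed

lemma fourier_laplace_continuous:
  assumes \<phi>: "test_function \<phi>"
  shows "isCont (fourier_laplace \<phi>) \<zeta>"
  unfolding continuous_at_sequentially
proof (intro allI impI)
  fix z assume z: "z \<longlonglongrightarrow> \<zeta>"
  then obtain B where B: "\<And>n. norm (z n) \<le> B"
    using convergent_imp_Bseq[of z] unfolding convergent_def Bseq_def by blast
  have "(\<lambda>n. fourier_laplace \<phi> (z n)) \<longlonglongrightarrow> fourier_laplace \<phi> \<zeta>"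
    unfolding fourier_laplace_def
  proof (rule integral_dominated_convergence)
    show "integrable lborel (\<lambda>y. norm (complex_of_real (exp (B * \<bar>y\<bar>)) * \<phi> y))"
      by (intro integrable_norm integrable_mult_test_function[OF \<phi>] continuous_intros)
    show "AE y in lborel. norm (exp (- \<i> * z n * complex_of_real y) * \<phi> y)
        \<le> norm (complex_of_real (exp (B * \<bar>y\<bar>)) * \<phi> y)" for n
    proof (rule AE_I2)
      fix y
      have "Im (z n) * y \<le> \<bar>Im (z n)\<bar> * \<bar>y\<bar>" by (metis abs_ge_self abs_mult)
      also have "\<dots> \<le> B * \<bar>y\<bar>" using B[of n] abs_Im_le_cmod[of "z n"] by (intro mult_right_mono) auto
      finally show "norm (exp (- \<i> * z n * complex_of_real y) * \<phi> y) \<le> norm (complex_of_real (exp (B * \<bar>y\<bar>)) * \<phi> y)"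
        by (auto simp: norm_mult intro!: mult_right_mono)
    qed
    show "AE y in lborel. (\<lambda>n. exp (- \<i> * z n * complex_of_real y) * \<phi> y) \<longlonglongrightarrow> exp (- \<i> * \<zeta> * complex_of_real y) * \<phi> y"
      by (intro AE_I2 tendsto_intros z)
    show "(\<lambda>y. exp (- \<i> * \<zeta> * complex_of_real y) * \<phi> y) \<in> borel_measurable lborel"
      by (intro borel_measurable_integrable integrable_mult_test_function[OF \<phi>] continuous_intros)
    show "(\<lambda>y. exp (- \<i> * z n * complex_of_real y) * \<phi> y) \<in> borel_measurable lborel" for n
      by (intro borel_measurable_integrable integrable_mult_test_function[OF \<phi>] continuous_intros)
  qed
  then show "((fourier_laplace \<phi>) \<circ> z) \<longlonglongrightarrow> fourier_laplace \<phi> \<zeta>" by (simp add: o_def)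
qed

lemma integrable_inverse_square: "integrable lborel (\<lambda>x::real. inverse ((1 + \<bar>x\<bar>)\<^sup>2))"
proof (rule Bochner_Integration.integrable_bound)
  show "integrable lborel (\<lambda>x::real. inverse (1 + x\<^sup>2))"
    using integrable_inverse_1_plus_square by (simp add: set_integrable_def einterval_def)
  show "AE x::real in lborel. norm (inverse ((1 + \<bar>x\<bar>)\<^sup>2)) \<le> norm (inverse (1 + x\<^sup>2))"
  proof (rule AE_I2)
    fix x :: real
    have "1 + x\<^sup>2 \<le> (1 + \<bar>x\<bar>)\<^sup>2" by (simp add: power2_eq_square algebra_simps)
    moreover have "1 + x\<^sup>2 > 0" by (simp add: add_pos_nonneg)
    ultimately show "norm (inverse ((1 + \<bar>x\<bar>)\<^sup>2)) \<le> norm (inverse (1 + x\<^sup>2))"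
      by (simp add: le_imp_inverse_le)
  qed
qed measurable

section \<open>Fourier inversion\<close>

lemma integral_exp_scaled_std_normal_density:
  assumes "n > 0"
  shows "(\<integral>\<tau>. exp (\<i> * of_real (s * \<tau>)) * of_real (std_normal_density (\<tau> / n)) \<partial>lborel)
    = of_real (n * exp (- (n * s)\<^sup>2 / 2))"
proof -
  have "(\<integral>\<tau>. exp (\<i> * of_real (s * \<tau>)) * of_real (std_normal_density (\<tau> / n)) \<partial>lborel)
     = n *\<^sub>R (\<integral>\<tau>. exp (\<i> * of_real (s * (n * \<tau>))) * of_real (std_normal_density \<tau>) \<partial>lborel)"
    using lborel_integral_real_affine[of n "\<lambda>\<tau>. exp (\<i> * of_real (s * \<tau>)) * of_real (std_normal_density (\<tau> / n))" 0] assms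
    by simp
  also have "(\<integral>\<tau>. exp (\<i> * of_real (s * (n * \<tau>))) * of_real (std_normal_density \<tau>) \<partial>lborel)
     = char std_normal_distribution (n * s)"
    unfolding char_def
    by (subst integral_density) (auto simp: scaleR_conv_of_real mult_ac intro!: Bochner_Integration.integral_cong)
  finally show ?thesis
    by (simp add: char_std_normal_distribution scaleR_conv_of_real)
qed

lemma std_normal_density_le: "std_normal_density x \<le> std_normal_density 0"
  unfolding std_normal_density_def by (intro mult_left_mono) auto

text \<open>A slowly varying Gaussian factor makes the inversion integral absolutely convergent as a
  double integral; carrying out the frequency integral first turns it into the average of \<open>g\<close>
  against a Gaussian that concentrates at \<open>y\<close>.\<close>

lemma fourier_inversion:
  fixes g :: "real \<Rightarrow> complex"
  assumes int: "integrable lborel g" and cont: "continuous_on UNIV g"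
    and bdd: "\<And>x. norm (g x) \<le> B" and int_hat: "integrable lborel (fourier g)"
  shows "(\<integral>\<tau>. exp (\<i> * of_real (y * \<tau>)) * fourier g \<tau> \<partial>lborel) = of_real (2 * pi) * g y"
proof -
  define \<phi> where "\<phi> = std_normal_density"
  have \<phi>_nonneg: "\<phi> x \<ge> 0" and \<phi>_le: "\<phi> x \<le> \<phi> 0" for x
    unfolding \<phi>_def using std_normal_density_le by auto
  have \<phi>_int: "integrable lborel \<phi>" unfolding \<phi>_def by simp
  have \<phi>_cont: "isCont \<phi> x" for x
    unfolding \<phi>_def std_normal_density_def by (intro continuous_intros) auto
  have [measurable]: "\<phi> \<in> borel_measurable borel" "g \<in> borel_measurable borel" "fourier g \<in> borel_measurable borel"
    using \<phi>_int int int_hat by (auto dest: borel_measurable_integrable)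
  define A where "A n = (\<integral>\<tau>. exp (\<i> * of_real (y * \<tau>)) * of_real (\<phi> (\<tau> / Suc n)) * fourier g \<tau> \<partial>lborel)" for n
  have lim1: "A \<longlonglongrightarrow> (\<integral>\<tau>. exp (\<i> * of_real (y * \<tau>)) * of_real (\<phi> 0) * fourier g \<tau> \<partial>lborel)"
    unfolding A_def
  proof (rule integral_dominated_convergence[where w = "\<lambda>\<tau>. \<phi> 0 * norm (fourier g \<tau>)"])
    show "integrable lborel (\<lambda>\<tau>. \<phi> 0 * norm (fourier g \<tau>))"
      using int_hat by (intro integrable_mult_right integrable_norm)
    show "AE \<tau> in lborel. (\<lambda>n. exp (\<i> * of_real (y * \<tau>)) * of_real (\<phi> (\<tau> / Suc n)) * fourier g \<tau>)
        \<longlonglongrightarrow> exp (\<i> * of_real (y * \<tau>)) * of_real (\<phi> 0) * fourier g \<tau>"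
    proof (rule AE_I2)
      fix \<tau> :: real
      have "(\<lambda>n. \<tau> / real (Suc n)) \<longlonglongrightarrow> 0"
        by (rule LIMSEQ_Suc[OF lim_const_over_n])
      then have "(\<lambda>n. \<phi> (\<tau> / Suc n)) \<longlonglongrightarrow> \<phi> 0"
        by (rule isCont_tendsto_compose[OF \<phi>_cont])
      then show "(\<lambda>n. exp (\<i> * of_real (y * \<tau>)) * of_real (\<phi> (\<tau> / Suc n)) * fourier g \<tau>)
        \<longlonglongrightarrow> exp (\<i> * of_real (y * \<tau>)) * of_real (\<phi> 0) * fourier g \<tau>"
        by (intro tendsto_intros)
    qed
    show "AE \<tau> in lborel. norm (exp (\<i> * of_real (y * \<tau>)) * of_real (\<phi> (\<tau> / Suc n)) * fourier g \<tau>)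
        \<le> \<phi> 0 * norm (fourier g \<tau>)" for n
      by (rule AE_I2) (auto simp: norm_mult \<phi>_nonneg intro!: mult_right_mono \<phi>_le)
  qed measurable
  have A_eq: "A n = (\<integral>w. g (y + w / Suc n) * of_real (sqrt (2 * pi) * \<phi> w) \<partial>lborel)" for n
  proof -
    define N where "N = real (Suc n)"
    have N: "N > 0" unfolding N_def by simp
    have scaled: "integrable lborel (\<lambda>\<tau>. \<phi> (\<tau> / N))"
      using lborel_integrable_real_affine[OF \<phi>_int, of "1 / N" 0] N by simp
    define h where "h \<tau> z = exp (\<i> * of_real ((y - z) * \<tau>)) * of_real (\<phi> (\<tau> / N)) * g z" for \<tau> z
    have norm_h: "norm (h \<tau> z) = \<phi> (\<tau> / N) * norm (g z)" for \<tau> z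
      by (simp add: h_def norm_mult \<phi>_nonneg)
    have h_meas: "(\<lambda>p. h (fst p) (snd p)) \<in> borel_measurable (lborel \<Otimes>\<^sub>M lborel)"
      unfolding h_def by measurable
    have h_int: "integrable (lborel \<Otimes>\<^sub>M lborel) (\<lambda>p. h (fst p) (snd p))"
    proof (rule lborel_pair.Fubini_integrable[OF h_meas])
      show "integrable lborel (\<lambda>\<tau>. \<integral>z. norm (h (fst (\<tau>, z)) (snd (\<tau>, z))) \<partial>lborel)"
        using scaled by (simp add: norm_h)
      show "AE \<tau> in lborel. integrable lborel (\<lambda>z. h (fst (\<tau>, z)) (snd (\<tau>, z)))"
      proof (rule AE_I2)
        fix \<tau> :: real
        have "integrable lborel (\<lambda>z. \<phi> (\<tau> / N) * norm (g z))"
          using int by (intro integrable_mult_right integrable_norm)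
        then show "integrable lborel (\<lambda>z. h (fst (\<tau>, z)) (snd (\<tau>, z)))"
          by (rule Bochner_Integration.integrable_bound) (auto simp: norm_h \<phi>_nonneg, simp add: h_def)
      qed
    qed
    have "A n = (\<integral>\<tau>. (\<integral>z. h \<tau> z \<partial>lborel) \<partial>lborel)"
      unfolding A_def
    proof (rule Bochner_Integration.integral_cong[OF refl])
      fix \<tau>
      have "(\<integral>z. h \<tau> z \<partial>lborel) = (\<integral>z. (exp (\<i> * of_real (y * \<tau>)) * of_real (\<phi> (\<tau> / N))) *
          (exp (- \<i> * of_real (z * \<tau>)) * g z) \<partial>lborel)"
        unfolding h_def
        by (intro Bochner_Integration.integral_cong refl)
           (simp add: left_diff_distrib right_diff_distrib exp_diff exp_minus field_simps)
      then show "exp (\<i> * of_real (y * \<tau>)) * of_real (\<phi> (\<tau> / Suc n)) * fourier g \<tau> = (\<integral>z. h \<tau> z \<partial>lborel)"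
        unfolding fourier_def N_def by simp
    qed
    also have "\<dots> = (\<integral>z. (\<integral>\<tau>. h \<tau> z \<partial>lborel) \<partial>lborel)"
      using h_int by (intro lborel_pair.Fubini_integral[symmetric]) (simp add: case_prod_unfold)
    also have "\<dots> = (\<integral>z. of_real (N * exp (- (N * (y - z))\<^sup>2 / 2)) * g z \<partial>lborel)"
      unfolding h_def \<phi>_def
      by (simp only: integral_mult_left_zero integral_exp_scaled_std_normal_density[OF N])
    also have "\<dots> = (1 / N) *\<^sub>R (\<integral>w. of_real (N * exp (- (N * (y - (y + 1 / N * w)))\<^sup>2 / 2)) * g (y + 1 / N * w) \<partial>lborel)"
      using lborel_integral_real_affine[of "1 / N" "\<lambda>z. of_real (N * exp (- (N * (y - z))\<^sup>2 / 2)) * g z" y] N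
      by simp
    also have "\<dots> = (\<integral>w. g (y + w / N) * of_real (sqrt (2 * pi) * \<phi> w) \<partial>lborel)"
    proof -
      have "N * (y - (y + 1 / N * w)) = - w" for w using N by (simp add: field_simps)
      then have "of_real (N * exp (- (N * (y - (y + 1 / N * w)))\<^sup>2 / 2)) * g (y + 1 / N * w)
          = N *\<^sub>R (g (y + w / N) * of_real (sqrt (2 * pi) * \<phi> w))" for w
        by (simp add: \<phi>_def std_normal_density_def scaleR_conv_of_real)
      then show ?thesis using N by simp
    qed
    finally show ?thesis unfolding N_def .
  qed
  have lim2: "A \<longlonglongrightarrow> (\<integral>w. g y * of_real (sqrt (2 * pi) * \<phi> w) \<partial>lborel)"
    unfolding A_eq
  proof (rule integral_dominated_convergence[where w = "\<lambda>w. B * (sqrt (2 * pi) * \<phi> w)"])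
    show "integrable lborel (\<lambda>w. B * (sqrt (2 * pi) * \<phi> w))"
      using \<phi>_int by (intro integrable_mult_right)
    show "AE w in lborel. (\<lambda>n. g (y + w / Suc n) * of_real (sqrt (2 * pi) * \<phi> w)) \<longlonglongrightarrow> g y * of_real (sqrt (2 * pi) * \<phi> w)"
    proof (rule AE_I2)
      fix w :: real
      have "(\<lambda>n. y + w / real (Suc n)) \<longlonglongrightarrow> y + 0"
        by (intro tendsto_add tendsto_const LIMSEQ_Suc[OF lim_const_over_n])
      moreover have "isCont g (y + 0)" using cont by (simp add: continuous_on_eq_continuous_at)
      ultimately have "(\<lambda>n. g (y + w / Suc n)) \<longlonglongrightarrow> g (y + 0)"
        by (rule isCont_tendsto_compose[rotated])
      then show "(\<lambda>n. g (y + w / Suc n) * of_real (sqrt (2 * pi) * \<phi> w)) \<longlonglongrightarrow> g y * of_real (sqrt (2 * pi) * \<phi> w)"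
        by (intro tendsto_intros) simp
    qed
    show "AE w in lborel. norm (g (y + w / Suc n) * of_real (sqrt (2 * pi) * \<phi> w)) \<le> B * (sqrt (2 * pi) * \<phi> w)" for n
      by (rule AE_I2) (auto simp: norm_mult \<phi>_nonneg intro!: mult_right_mono bdd)
  qed measurable
  have "(\<integral>w. g y * of_real (sqrt (2 * pi) * \<phi> w) \<partial>lborel) = g y * of_real (sqrt (2 * pi))"
    by (simp add: integral_complex_of_real \<phi>_def)
  moreover have "(\<integral>\<tau>. exp (\<i> * of_real (y * \<tau>)) * of_real (\<phi> 0) * fourier g \<tau> \<partial>lborel)
      = of_real (1 / sqrt (2 * pi)) * (\<integral>\<tau>. exp (\<i> * of_real (y * \<tau>)) * fourier g \<tau> \<partial>lborel)"
    by (subst integral_mult_right_zero[symmetric])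
       (auto simp: \<phi>_def std_normal_density_def mult_ac intro!: Bochner_Integration.integral_cong)
  ultimately have "of_real (1 / sqrt (2 * pi)) * (\<integral>\<tau>. exp (\<i> * of_real (y * \<tau>)) * fourier g \<tau> \<partial>lborel)
      = g y * of_real (sqrt (2 * pi))"
    using LIMSEQ_unique[OF lim1 lim2] by simp
  then have "(of_real (sqrt (2 * pi)) * of_real (1 / sqrt (2 * pi))) * (\<integral>\<tau>. exp (\<i> * of_real (y * \<tau>)) * fourier g \<tau> \<partial>lborel)
      = (of_real (sqrt (2 * pi)) * of_real (sqrt (2 * pi))) * g y"
    by (simp only: mult.assoc mult.left_commute mult.commute)
  moreover have "complex_of_real (sqrt (2 * pi)) * of_real (1 / sqrt (2 * pi)) = 1"
    unfolding of_real_mult[symmetric] by simp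
  moreover have "complex_of_real (sqrt (2 * pi)) * of_real (sqrt (2 * pi)) = of_real (2 * pi)"
    unfolding of_real_mult[symmetric] by simp
  ultimately show ?thesis by simp
qed

section \<open>The leading behaviour of a classical symbol\<close>

lemma classical_symbol_continuous:
  assumes "classical_symbol r c p"
  shows "continuous_on UNIV c"
proof -
  obtain \<eta> :: "real \<Rightarrow> real" and a :: "nat \<Rightarrow> real \<times> real \<Rightarrow> complex" where
    "\<forall>N. is_symbol (r - real N) (\<lambda>(x, \<xi>). c (x, \<xi>) - of_real (\<eta> \<xi>) * (\<Sum>j<N. a j (x, \<xi>)))"
    using assms unfolding classical_symbol_def by blast
  from this[rule_format, of 0] have "smooth_on UNIV c"
    unfolding is_symbol_def by (simp add: case_prod_unfold)
  then have "iter_deriv [] c differentiable (at x)" for x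
    unfolding smooth_on_def by blast
  then show ?thesis
    by (auto intro!: continuous_at_imp_continuous_on differentiable_imp_continuous_within)
qed

text \<open>The remainders of the expansion after no term and after one term.\<close>

lemma classical_symbol_order:
  assumes "classical_symbol r c p" "compact K"
  shows "\<exists>C\<ge>0. \<forall>x\<in>K. \<forall>\<xi>. norm (c (x, \<xi>)) \<le> C * (1 + \<bar>\<xi>\<bar>) powr r"
proof -
  obtain \<eta> :: "real \<Rightarrow> real" and a :: "nat \<Rightarrow> real \<times> real \<Rightarrow> complex" where
    "\<forall>N. is_symbol (r - real N) (\<lambda>(x, \<xi>). c (x, \<xi>) - of_real (\<eta> \<xi>) * (\<Sum>j<N. a j (x, \<xi>)))"
    using assms unfolding classical_symbol_def by blast
  from this[rule_format, of 0] have "\<forall>K \<alpha> \<beta>. compact K \<longrightarrow> (\<exists>C. \<forall>x\<in>K. \<forall>\<xi>.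
        norm (iter_deriv (replicate \<alpha> (1, 0) @ replicate \<beta> (0, 1)) c (x, \<xi>))
          \<le> C * (1 + \<bar>\<xi>\<bar>) powr (r - real \<beta>))"
    unfolding is_symbol_def by (simp add: case_prod_unfold)
  from this[rule_format, OF assms(2), of 0 0]
  obtain C where C: "\<And>x \<xi>. x \<in> K \<Longrightarrow> norm (c (x, \<xi>)) \<le> C * (1 + \<bar>\<xi>\<bar>) powr r"
    by auto
  have "C * (1 + \<bar>\<xi>\<bar>) powr r \<le> \<bar>C\<bar> * (1 + \<bar>\<xi>\<bar>) powr r" for \<xi>
    by (intro mult_right_mono) auto
  then show ?thesis
    using C by (intro exI[of _ "\<bar>C\<bar>"]) (auto intro: order_trans)
qed

lemma classical_symbol_principal:
  assumes "classical_symbol r c p" "compact K"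
  shows "\<exists>C. \<forall>x\<in>K. \<forall>\<xi>. \<bar>\<xi>\<bar> \<ge> 1 \<longrightarrow> norm (c (x, \<xi>) - p (x, \<xi>)) \<le> C * (1 + \<bar>\<xi>\<bar>) powr (r - 1)"
proof -
  obtain \<eta> :: "real \<Rightarrow> real" and a :: "nat \<Rightarrow> real \<times> real \<Rightarrow> complex" where
    \<eta>: "\<forall>\<xi>. \<bar>\<xi>\<bar> \<ge> 1 \<longrightarrow> \<eta> \<xi> = 1" and a: "\<forall>x \<xi>. \<xi> \<noteq> 0 \<longrightarrow> a 0 (x, \<xi>) = p (x, \<xi>)"
    and "\<forall>N. is_symbol (r - real N) (\<lambda>(x, \<xi>). c (x, \<xi>) - of_real (\<eta> \<xi>) * (\<Sum>j<N. a j (x, \<xi>)))"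
    using assms unfolding classical_symbol_def by blast
  from this(3)[rule_format, of 1] have "\<forall>K \<alpha> \<beta>. compact K \<longrightarrow> (\<exists>C. \<forall>x\<in>K. \<forall>\<xi>.
        norm (iter_deriv (replicate \<alpha> (1, 0) @ replicate \<beta> (0, 1))
          (\<lambda>(x, \<xi>). c (x, \<xi>) - of_real (\<eta> \<xi>) * (\<Sum>j<1. a j (x, \<xi>))) (x, \<xi>))
          \<le> C * (1 + \<bar>\<xi>\<bar>) powr (r - real 1 - real \<beta>))"
    unfolding is_symbol_def by blast
  from this[rule_format, OF assms(2), of 0 0]
  obtain C where C: "\<And>x \<xi>. x \<in> K \<Longrightarrow> norm (c (x, \<xi>) - of_real (\<eta> \<xi>) * a 0 (x, \<xi>)) \<le> C * (1 + \<bar>\<xi>\<bar>) powr (r - 1)"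
    by auto
  have "norm (c (x, \<xi>) - p (x, \<xi>)) \<le> C * (1 + \<bar>\<xi>\<bar>) powr (r - 1)" if "x \<in> K" "\<bar>\<xi>\<bar> \<ge> 1" for x \<xi>
  proof -
    have "\<eta> \<xi> = 1" "a 0 (x, \<xi>) = p (x, \<xi>)" using \<eta> a that(2) by auto
    then show ?thesis using C[OF that(1), of \<xi>] by simp
  qed
  then show ?thesis by blast
qed

lemma classical_symbol_imp_smooth_step:
  assumes "classical_symbol r c p"
  shows "\<exists>S. smooth_step S"
proof -
  obtain \<eta> :: "real \<Rightarrow> real" where
    "smooth_on UNIV \<eta>" "\<forall>\<xi>. \<bar>\<xi>\<bar> \<le> 1 / 2 \<longrightarrow> \<eta> \<xi> = 0" "\<forall>\<xi>. \<bar>\<xi>\<bar> \<ge> 1 \<longrightarrow> \<eta> \<xi> = 1"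
    using assms unfolding classical_symbol_def by blast
  then show ?thesis using smooth_step_of_excision by blast
qed

lemma tendsto_one_plus_over:
  assumes "((\<lambda>k. \<bar>\<xi> k\<bar> / k) \<longlongrightarrow> 1) at_top"
  shows "((\<lambda>k::real. (1 + \<bar>\<xi> k\<bar>) / k) \<longlongrightarrow> 1) at_top"
proof -
  have "((\<lambda>k. 1 / k + \<bar>\<xi> k\<bar> / k) \<longlongrightarrow> 0 + 1) at_top"
    by (intro tendsto_add assms) real_asymp
  then show ?thesis by (simp add: add_divide_distrib)
qed

text \<open>The remainder is smaller than the principal part by one power of \<open>k\<close>, and the principal part
  depends on \<open>\<bar>\<xi>\<bar>\<close> only.\<close>

lemma classical_symbol_limit:
  assumes c: "classical_symbol (- m) c (\<lambda>(x, \<xi>). of_real (\<mu> x * \<bar>\<xi>\<bar> powr (- m)))"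
    and \<xi>: "((\<lambda>k. \<bar>\<xi> k\<bar> / k) \<longlongrightarrow> 1) at_top"
  shows "((\<lambda>k. of_real (k powr m) * c (y, \<xi> k)) \<longlongrightarrow> of_real (\<mu> y)) at_top"
proof -
  obtain C where C: "\<And>t. \<bar>t\<bar> \<ge> 1 \<Longrightarrow>
      norm (c (y, t) - of_real (\<mu> y * \<bar>t\<bar> powr (- m))) \<le> C * (1 + \<bar>t\<bar>) powr (- m - 1)"
    using classical_symbol_principal[OF c, of "{y}"] by auto
  have large: "\<forall>\<^sub>F k in at_top. k > 0 \<and> \<bar>\<xi> k\<bar> \<ge> 1"
  proof -
    have "\<forall>\<^sub>F k in at_top. \<bar>\<xi> k\<bar> / k > 1 / 2"
      using order_tendstoD(1)[OF \<xi>, of "1/2"] by simp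
    then show ?thesis
      using eventually_gt_at_top[of 2] by eventually_elim (auto simp: field_simps)
  qed
  have lim1: "((\<lambda>k. of_real (k powr m * (\<mu> y * \<bar>\<xi> k\<bar> powr (- m)))) \<longlongrightarrow> complex_of_real (\<mu> y)) at_top"
  proof -
    have "((\<lambda>k. \<mu> y * (\<bar>\<xi> k\<bar> / k) powr (- m)) \<longlongrightarrow> \<mu> y * 1 powr (- m)) at_top"
      by (intro tendsto_intros \<xi>) simp
    moreover have "\<forall>\<^sub>F k in at_top. \<mu> y * (\<bar>\<xi> k\<bar> / k) powr (- m) = k powr m * (\<mu> y * \<bar>\<xi> k\<bar> powr (- m))"
      using large by eventually_elim (simp add: powr_divide powr_minus field_simps)
    ultimately have "((\<lambda>k. k powr m * (\<mu> y * \<bar>\<xi> k\<bar> powr (- m))) \<longlongrightarrow> \<mu> y) at_top"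
      using Lim_transform_eventually by fastforce
    then show ?thesis by (rule tendsto_of_real)
  qed
  have lim2: "((\<lambda>k. of_real (k powr m) * (c (y, \<xi> k) - of_real (\<mu> y * \<bar>\<xi> k\<bar> powr (- m)))) \<longlongrightarrow> 0) at_top"
  proof (rule Lim_null_comparison)
    let ?R = "\<lambda>k. C * ((1 + \<bar>\<xi> k\<bar>) / k) powr (- m - 1) * (1 / k)"
    show "\<forall>\<^sub>F k in at_top. norm (of_real (k powr m) * (c (y, \<xi> k) - of_real (\<mu> y * \<bar>\<xi> k\<bar> powr (- m)))) \<le> ?R k"
      using large
    proof eventually_elim
      case (elim k)
      have "norm (of_real (k powr m) * (c (y, \<xi> k) - of_real (\<mu> y * \<bar>\<xi> k\<bar> powr (- m))))
          \<le> k powr m * (C * (1 + \<bar>\<xi> k\<bar>) powr (- m - 1))"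
        using C[of "\<xi> k"] elim by (simp add: norm_mult mult_left_mono)
      also have "k powr m * (C * (1 + \<bar>\<xi> k\<bar>) powr (- m - 1)) = ?R k"
      proof -
        have "k powr (- m - 1) * (k powr m * k) = k powr ((- m - 1) + m + 1)"
          using elim by (subst powr_add, subst powr_add) (simp add: mult.assoc)
        then have "k powr m = 1 / k powr (- m - 1) * (1 / k)"
          using elim by (simp add: field_simps)
        then show ?thesis using elim by (simp add: powr_divide)
      qed
      finally show ?case .
    qed
    have "(?R \<longlongrightarrow> C * 1 powr (- m - 1) * 0) at_top"
      by (intro tendsto_intros tendsto_one_plus_over[OF \<xi>]) (simp, real_asymp)
    then show "(?R \<longlongrightarrow> 0) at_top" by simp
  qed
  show ?thesis
    using tendsto_add[OF lim1 lim2] by (simp add: algebra_simps)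
qed

lemma peetre_inequality:
  fixes \<tau> a m :: real
  shows "(1 + \<bar>\<tau> - a\<bar>) powr (- m) \<le> (1 + \<bar>a\<bar>) powr (- m) * (1 + \<bar>\<tau>\<bar>) powr \<bar>m\<bar>"
proof (cases "m \<ge> 0")
  case True
  have "(1 + \<bar>a\<bar>) powr m \<le> ((1 + \<bar>\<tau> - a\<bar>) * (1 + \<bar>\<tau>\<bar>)) powr m"
  proof (rule powr_mono2[OF True])
    have "1 + \<bar>a\<bar> \<le> 1 + \<bar>\<tau> - a\<bar> + \<bar>\<tau>\<bar>" by linarith
    also have "\<dots> \<le> (1 + \<bar>\<tau> - a\<bar>) * (1 + \<bar>\<tau>\<bar>)" by (simp add: algebra_simps)
    finally show "1 + \<bar>a\<bar> \<le> (1 + \<bar>\<tau> - a\<bar>) * (1 + \<bar>\<tau>\<bar>)" .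
  qed simp
  then have "(1 + \<bar>a\<bar>) powr m \<le> (1 + \<bar>\<tau> - a\<bar>) powr m * (1 + \<bar>\<tau>\<bar>) powr m"
    by (simp add: powr_mult)
  moreover have "(1 + \<bar>a\<bar>) powr m > 0" "(1 + \<bar>\<tau> - a\<bar>) powr m > 0" by (auto simp: add_pos_nonneg)
  ultimately show ?thesis using True by (simp add: powr_minus field_simps)
next
  case False
  have "(1 + \<bar>\<tau> - a\<bar>) powr (- m) \<le> ((1 + \<bar>a\<bar>) * (1 + \<bar>\<tau>\<bar>)) powr (- m)"
  proof (rule powr_mono2)
    have "1 + \<bar>\<tau> - a\<bar> \<le> 1 + \<bar>a\<bar> + \<bar>\<tau>\<bar>" by linarith
    also have "\<dots> \<le> (1 + \<bar>a\<bar>) * (1 + \<bar>\<tau>\<bar>)" by (simp add: algebra_simps)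
    finally show "1 + \<bar>\<tau> - a\<bar> \<le> (1 + \<bar>a\<bar>) * (1 + \<bar>\<tau>\<bar>)" .
  qed (use False in auto)
  then show ?thesis using False by (simp add: powr_mult)
qed

section \<open>The wave number\<close>

lemma wave_number_properties:
  assumes "\<sigma> > 0" "k > 0"
  shows "Re (wave_number \<sigma> k) ^ 2 - Im (wave_number \<sigma> k) ^ 2 = k ^ 2"
    and "2 * Re (wave_number \<sigma> k) * Im (wave_number \<sigma> k) = k * \<sigma>"
    and "Re (wave_number \<sigma> k) > 0" and "Im (wave_number \<sigma> k) > 0"
proof -
  let ?z = "complex_of_real (k\<^sup>2) + \<i> * complex_of_real (k * \<sigma>)"
  let ?P = "\<lambda>\<kappa>. \<kappa>\<^sup>2 = ?z \<and> Re \<kappa> > 0 \<and> Im \<kappa> > 0"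
  have Re: "Re (w\<^sup>2) = Re w ^ 2 - Im w ^ 2" and Im: "Im (w\<^sup>2) = 2 * Re w * Im w" for w
    by (auto simp: power2_eq_square)
  have "(csqrt ?z)\<^sup>2 = ?z" by (rule power2_csqrt)
  moreover have "0 \<le> Re (csqrt ?z)" using csqrt_principal[of ?z] by (elim disjE conjE) linarith+
  ultimately obtain w where w: "w\<^sup>2 = ?z" "0 \<le> Re w" by blast
  have "2 * Re w * Im w = k * \<sigma>"
    unfolding Im[symmetric] w(1) by simp
  moreover have "k * \<sigma> > 0" using assms by simp
  ultimately have "Re w > 0 \<and> Im w > 0"
    using w(2) by (smt (verit) mult_nonneg_nonpos mult_eq_0_iff)
  then have "?P w" using w(1) by blast
  moreover have "\<kappa> = \<kappa>'" if "?P \<kappa>" "?P \<kappa>'" for \<kappa> \<kappa>'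
  proof -
    have "\<kappa> = \<kappa>' \<or> \<kappa> = - \<kappa>'" using that power2_eq_iff by metis
    then show ?thesis using that by auto
  qed
  ultimately have "\<exists>!\<kappa>. ?P \<kappa>" by blast
  from theI'[OF this] have P: "?P (wave_number \<sigma> k)" unfolding wave_number_def .
  then show "Re (wave_number \<sigma> k) > 0" "Im (wave_number \<sigma> k) > 0" by auto
  have "Re ((wave_number \<sigma> k)\<^sup>2) = k\<^sup>2" "Im ((wave_number \<sigma> k)\<^sup>2) = k * \<sigma>" using P by auto
  then show "Re (wave_number \<sigma> k) ^ 2 - Im (wave_number \<sigma> k) ^ 2 = k ^ 2"
    "2 * Re (wave_number \<sigma> k) * Im (wave_number \<sigma> k) = k * \<sigma>"
    by (simp_all add: Re Im)
qed

text \<open>Comparing real and imaginary parts of \<open>\<kappa>\<^sup>2\<close> gives \<open>k \<le> Re \<kappa>\<close> and then \<open>Im \<kappa> \<le> \<sigma> / 2\<close>, which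
  confines \<open>Re \<kappa>\<close> to \<open>[k, k + \<sigma> / 2]\<close>; the limit of \<open>Im \<kappa>\<close> follows from \<open>2 Re \<kappa> Im \<kappa> = k \<sigma>\<close>.\<close>

lemma wave_number_asymptotics:
  assumes \<sigma>: "\<sigma> > 0"
  shows "((\<lambda>k. Re (wave_number \<sigma> k) / k) \<longlongrightarrow> 1) at_top"
    and "((\<lambda>k. Im (wave_number \<sigma> k)) \<longlongrightarrow> \<sigma> / 2) at_top"
    and "((\<lambda>k. k\<^sup>2 / (norm (wave_number \<sigma> k))\<^sup>2) \<longlongrightarrow> 1) at_top"
proof -
  have bounds: "k \<le> Re (wave_number \<sigma> k) \<and> Re (wave_number \<sigma> k) \<le> k + \<sigma> / 2" if k: "k > 0" for k
  proof -
    define r p where "r = Re (wave_number \<sigma> k)" and "p = Im (wave_number \<sigma> k)"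
    have rp: "r\<^sup>2 - p\<^sup>2 = k\<^sup>2" "2 * r * p = k * \<sigma>" "r > 0" "p > 0"
      using wave_number_properties[OF \<sigma> k] unfolding r_def p_def by auto
    have "k\<^sup>2 \<le> r\<^sup>2" using rp(1) zero_le_power2[of p] by linarith
    then have le: "k \<le> r" using rp(3) by (simp add: power2_le_iff_abs_le k)
    then have "k * (2 * p) \<le> r * (2 * p)" using rp(4) by (intro mult_right_mono) auto
    then have "k * (2 * p) \<le> k * \<sigma>" using rp(2) by (simp add: mult_ac)
    then have "2 * p \<le> \<sigma>" using k by simp
    then have "p\<^sup>2 \<le> (\<sigma> / 2)\<^sup>2" using rp(4) by (intro power_mono) auto
    moreover have "k\<^sup>2 + (\<sigma> / 2)\<^sup>2 \<le> (k + \<sigma> / 2)\<^sup>2"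
      using k \<sigma> by (simp add: power2_eq_square algebra_simps)
    ultimately have "r\<^sup>2 \<le> (k + \<sigma> / 2)\<^sup>2" using rp(1) by linarith
    then have "r \<le> k + \<sigma> / 2" by (rule power2_le_imp_le) (use k \<sigma> in simp)
    then show ?thesis using le unfolding r_def by simp
  qed
  show lim1: "((\<lambda>k. Re (wave_number \<sigma> k) / k) \<longlongrightarrow> 1) at_top"
  proof (rule tendsto_sandwich[where f = "\<lambda>_. 1" and h = "\<lambda>k. (k + \<sigma> / 2) / k"])
    show "\<forall>\<^sub>F k in at_top. 1 \<le> Re (wave_number \<sigma> k) / k"
      using eventually_gt_at_top[of 0] by eventually_elim (use bounds in auto)
    show "\<forall>\<^sub>F k in at_top. Re (wave_number \<sigma> k) / k \<le> (k + \<sigma> / 2) / k"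
      using eventually_gt_at_top[of 0]
    proof eventually_elim
      case (elim k)
      then show ?case using bounds[OF elim] by (intro divide_right_mono) auto
    qed
    show "((\<lambda>k. (k + \<sigma> / 2) / k) \<longlongrightarrow> 1) at_top" by real_asymp
  qed simp
  have "((\<lambda>k. \<sigma> / 2 / (Re (wave_number \<sigma> k) / k)) \<longlongrightarrow> \<sigma> / 2 / 1) at_top"
    by (intro tendsto_intros lim1) simp
  moreover have "\<forall>\<^sub>F k in at_top. \<sigma> / 2 / (Re (wave_number \<sigma> k) / k) = Im (wave_number \<sigma> k)"
    using eventually_gt_at_top[of 0]
  proof eventually_elim
    case (elim k)
    then show ?case using wave_number_properties(2,3)[OF \<sigma> elim] by (simp add: field_simps)
  qed
  ultimately show lim2: "((\<lambda>k. Im (wave_number \<sigma> k)) \<longlongrightarrow> \<sigma> / 2) at_top"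
    using Lim_transform_eventually by fastforce
  have inv: "((\<lambda>k::real. 1 / k) \<longlongrightarrow> 0) at_top" by real_asymp
  have "((\<lambda>k. 1 / ((Re (wave_number \<sigma> k) / k)\<^sup>2 + (Im (wave_number \<sigma> k) * (1 / k))\<^sup>2)) \<longlongrightarrow>
      1 / (1\<^sup>2 + (\<sigma> / 2 * 0)\<^sup>2)) at_top"
    by (intro tendsto_intros lim1 lim2 inv) simp
  moreover have "\<forall>\<^sub>F k in at_top. 1 / ((Re (wave_number \<sigma> k) / k)\<^sup>2 + (Im (wave_number \<sigma> k) * (1 / k))\<^sup>2)
      = k\<^sup>2 / (norm (wave_number \<sigma> k))\<^sup>2"
    using eventually_gt_at_top[of 0]
    by eventually_elim (simp add: cmod_power2 power_divide add_divide_distrib[symmetric])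
  ultimately show "((\<lambda>k. k\<^sup>2 / (norm (wave_number \<sigma> k))\<^sup>2) \<longlongrightarrow> 1) at_top"
    using Lim_transform_eventually by fastforce
qed

section \<open>The covariance of a modulated cutoff\<close>

lemma test_function_bounded:
  assumes \<phi>: "test_function_on V \<phi>"
  shows "\<exists>B. \<forall>x. norm (\<phi> x) \<le> B"
proof -
  obtain R where R: "R > 0" "\<And>x. x \<notin> {-R<..<R} \<Longrightarrow> \<phi> x = 0"
    using test_function_bounded_support[OF \<phi>] by blast
  have "continuous_on {-R..R} \<phi>"
    using \<phi> smooth_on_continuous unfolding test_function_on_def by blast
  then have "bounded (\<phi> ` {-R..R})"
    by (intro compact_imp_bounded compact_continuous_image) auto
  then obtain B where B: "B > 0" "\<forall>z\<in>\<phi> ` {-R..R}. norm z \<le> B"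
    unfolding bounded_pos by blast
  have "norm (\<phi> x) \<le> B" for x
  proof (cases "x \<in> {-R..R}")
    case False
    then have "\<phi> x = 0" by (intro R(2)) auto
    then show ?thesis using B(1) by simp
  qed (use B in auto)
  then show ?thesis by blast
qed

lemma continuous_fourier_laplace_line:
  assumes "test_function \<phi>"
  shows "continuous_on UNIV (\<lambda>\<tau>. fourier_laplace \<phi> (of_real \<tau> - \<i> * of_real q))"
proof (intro continuous_at_imp_continuous_on ballI)
  fix \<tau>
  have "isCont (\<lambda>\<tau>. complex_of_real \<tau> - \<i> * of_real q) \<tau>" by (intro continuous_intros)
  then show "isCont (\<lambda>\<tau>. fourier_laplace \<phi> (of_real \<tau> - \<i> * of_real q)) \<tau>"
    using fourier_laplace_continuous[OF assms] by (rule isCont_o2)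
qed

text \<open>On a horizontal line the Fourier-Laplace transform is the Fourier transform of an
  exponentially weighted function.\<close>

lemma fourier_laplace_inversion:
  assumes \<phi>: "test_function \<phi>"
  shows "(\<integral>\<tau>. exp (\<i> * of_real (y * \<tau>)) * fourier_laplace \<phi> (of_real \<tau> - \<i> * of_real q) \<partial>lborel)
    = of_real (2 * pi * exp (- q * y)) * \<phi> y"
proof -
  define g where "g y = exp (of_real (- q) * complex_of_real y) * \<phi> y" for y
  have g: "test_function g"
    using test_function_on_mult[OF \<phi> smooth_on_exp[of "of_real (- q)"]] unfolding g_def by (simp add: mult.commute)
  have g_cont: "continuous_on UNIV g"
    using g smooth_on_continuous unfolding test_function_on_def by blast
  have hat: "fourier g = (\<lambda>\<tau>. fourier_laplace \<phi> (of_real \<tau> - \<i> * of_real q))"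
  proof
    fix \<tau>
    have "exp (- \<i> * of_real (y * \<tau>)) * g y = exp (- \<i> * (of_real \<tau> - \<i> * of_real q) * of_real y) * \<phi> y" for y
      unfolding g_def mult.assoc[symmetric] exp_add[symmetric]
      by (intro arg_cong2[where f = "(*)"] arg_cong[where f = exp] refl) (simp add: complex_eq_iff)
    then show "fourier g \<tau> = fourier_laplace \<phi> (of_real \<tau> - \<i> * of_real q)"
      unfolding fourier_def fourier_laplace_def by presburger
  qed
  obtain C where C: "\<forall>\<zeta>. \<bar>Im \<zeta>\<bar> \<le> \<bar>q\<bar> \<longrightarrow> (1 + \<bar>Re \<zeta>\<bar>) ^ 2 * norm (fourier_laplace \<phi> \<zeta>) \<le> C"
    using fourier_laplace_decay[OF \<phi>] by blast
  have hat_int: "integrable lborel (fourier g)"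
  proof (rule Bochner_Integration.integrable_bound)
    show "integrable lborel (\<lambda>\<tau>::real. C * inverse ((1 + \<bar>\<tau>\<bar>)\<^sup>2))"
      by (intro integrable_mult_right integrable_inverse_square)
    show "fourier g \<in> borel_measurable lborel"
      unfolding hat using borel_measurable_continuous_onI[OF continuous_fourier_laplace_line[OF \<phi>]] by simp
    show "AE \<tau>::real in lborel. norm (fourier g \<tau>) \<le> norm (C * inverse ((1 + \<bar>\<tau>\<bar>)\<^sup>2))"
    proof (rule AE_I2)
      fix \<tau> :: real
      have pos: "(1 + \<bar>\<tau>\<bar>)\<^sup>2 > 0" by (simp add: add_pos_nonneg)
      have "(1 + \<bar>\<tau>\<bar>)\<^sup>2 * norm (fourier g \<tau>) \<le> C"
        using C[rule_format, of "of_real \<tau> - \<i> * of_real q"] unfolding hat by simp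
      then have "norm (fourier g \<tau>) \<le> C * inverse ((1 + \<bar>\<tau>\<bar>)\<^sup>2)"
        using pos by (simp add: field_simps)
      then show "norm (fourier g \<tau>) \<le> norm (C * inverse ((1 + \<bar>\<tau>\<bar>)\<^sup>2))"
        unfolding real_norm_def by linarith
    qed
  qed
  obtain B where B: "\<forall>x. norm (g x) \<le> B" using test_function_bounded[OF g] by blast
  have "integrable lborel g"
    using integrable_mult_test_function[OF g, of "\<lambda>_. 1"] by simp
  from fourier_inversion[OF this g_cont B[rule_format] hat_int, of y]
  have "(\<integral>\<tau>. exp (\<i> * of_real (y * \<tau>)) * fourier_laplace \<phi> (of_real \<tau> - \<i> * of_real q) \<partial>lborel) = of_real (2 * pi) * g y"
    unfolding hat .
  then show ?thesis unfolding g_def by (simp add: exp_of_real[symmetric] mult.assoc)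
qed

text \<open>Modulation by \<open>exp (\<i> \<kappa> s y)\<close> shifts the frequency variable of the symbol by
  \<open>- s Re \<kappa>\<close>; the imaginary part of the wave number only contributes exponential weights.\<close>

lemma psido_modulated:
  fixes \<eta> :: "real \<Rightarrow> complex" and s x y :: real and \<kappa> :: complex
  assumes real: "\<And>y. cnj (\<eta> y) = \<eta> y"
  defines "\<phi> \<equiv> \<lambda>y. \<eta> y * exp (\<i> * \<kappa> * of_real (s * (y - x)))"
  shows "\<phi> y * psido c (\<lambda>y. cnj (\<phi> y)) y =
    \<eta> y * of_real (exp (s * Im \<kappa> * (2 * x - y)) / (2 * pi)) *
      (\<integral>\<tau>. exp (\<i> * of_real (y * \<tau>)) * c (y, \<tau> - s * Re \<kappa>) *
        fourier_laplace \<eta> (of_real \<tau> - \<i> * of_real (s * Im \<kappa>)) \<partial>lborel)"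
proof -
  let ?a = "exp (\<i> * cnj \<kappa> * of_real (s * x))"
  let ?I = "\<integral>\<tau>. exp (\<i> * of_real (y * \<tau>)) * c (y, \<tau> - s * Re \<kappa>) *
        fourier_laplace \<eta> (of_real \<tau> - \<i> * of_real (s * Im \<kappa>)) \<partial>lborel"
  have hat: "fourier (\<lambda>y. cnj (\<phi> y)) \<xi> = ?a * fourier_laplace \<eta> (of_real \<xi> + of_real s * cnj \<kappa>)" for \<xi>
  proof -
    have "exp (- \<i> * of_real (z * \<xi>)) * cnj (\<phi> z) =
        ?a * (exp (- \<i> * (of_real \<xi> + of_real s * cnj \<kappa>) * of_real z) * \<eta> z)" for z
    proof -
      have "exp (- \<i> * of_real (z * \<xi>)) * cnj (exp (\<i> * \<kappa> * of_real (s * (z - x)))) =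
          ?a * exp (- \<i> * (of_real \<xi> + of_real s * cnj \<kappa>) * of_real z)"
        unfolding exp_cnj exp_add[symmetric]
        by (rule arg_cong[where f = exp]) (simp add: complex_eq_iff algebra_simps)
      then show ?thesis unfolding \<phi>_def complex_cnj_mult real by (simp add: mult_ac)
    qed
    then show ?thesis
      unfolding fourier_def fourier_laplace_def by simp
  qed
  have "(\<integral>\<xi>. exp (\<i> * of_real (y * \<xi>)) * c (y, \<xi>) * fourier (\<lambda>y. cnj (\<phi> y)) \<xi> \<partial>lborel)
    = (\<integral>\<tau>. exp (\<i> * of_real (y * (- (s * Re \<kappa>) + 1 * \<tau>))) * c (y, - (s * Re \<kappa>) + 1 * \<tau>) *
        fourier (\<lambda>y. cnj (\<phi> y)) (- (s * Re \<kappa>) + 1 * \<tau>) \<partial>lborel)"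
    by (subst lborel_integral_real_affine[of 1 _ "- (s * Re \<kappa>)"]) simp_all
  also have "\<dots> = (\<integral>\<tau>. (exp (- \<i> * of_real (y * s * Re \<kappa>)) * ?a) * (exp (\<i> * of_real (y * \<tau>)) * c (y, \<tau> - s * Re \<kappa>) *
        fourier_laplace \<eta> (of_real \<tau> - \<i> * of_real (s * Im \<kappa>))) \<partial>lborel)"
  proof (rule Bochner_Integration.integral_cong[OF refl])
    fix \<tau> :: real
    have 1: "- (s * Re \<kappa>) + 1 * \<tau> = \<tau> - s * Re \<kappa>" by simp
    have 2: "complex_of_real (\<tau> - s * Re \<kappa>) + of_real s * cnj \<kappa> = of_real \<tau> - \<i> * of_real (s * Im \<kappa>)"
      by (simp add: complex_eq_iff)
    have 3: "exp (\<i> * of_real (y * (\<tau> - s * Re \<kappa>))) = exp (- \<i> * of_real (y * s * Re \<kappa>)) * exp (\<i> * of_real (y * \<tau>))"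
      unfolding exp_add[symmetric] by (rule arg_cong[where f = exp]) (simp add: complex_eq_iff algebra_simps)
    show "exp (\<i> * of_real (y * (- (s * Re \<kappa>) + 1 * \<tau>))) * c (y, - (s * Re \<kappa>) + 1 * \<tau>) *
        fourier (\<lambda>y. cnj (\<phi> y)) (- (s * Re \<kappa>) + 1 * \<tau>)
      = (exp (- \<i> * of_real (y * s * Re \<kappa>)) * ?a) * (exp (\<i> * of_real (y * \<tau>)) * c (y, \<tau> - s * Re \<kappa>) *
        fourier_laplace \<eta> (of_real \<tau> - \<i> * of_real (s * Im \<kappa>)))"
      unfolding 1 hat 2 3 by (simp only: mult_ac)
  qed
  also have "\<dots> = (exp (- \<i> * of_real (y * s * Re \<kappa>)) * ?a) * ?I"
    by (rule integral_mult_right_zero)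
  finally have "\<phi> y * psido c (\<lambda>y. cnj (\<phi> y)) y = \<eta> y * (exp (\<i> * \<kappa> * of_real (s * (y - x))) *
      (exp (- \<i> * of_real (y * s * Re \<kappa>)) * ?a)) * of_real (1 / (2 * pi)) * ?I"
    unfolding psido_def \<phi>_def by (simp only: mult_ac)
  also have "exp (\<i> * \<kappa> * of_real (s * (y - x))) * (exp (- \<i> * of_real (y * s * Re \<kappa>)) * ?a)
      = of_real (exp (s * Im \<kappa> * (2 * x - y)))"
    unfolding exp_add[symmetric] exp_of_real[symmetric]
    by (rule arg_cong[where f = exp]) (simp add: complex_eq_iff algebra_simps)
  finally show ?thesis by (simp add: mult_ac)
qed

text \<open>By Peetre's inequality the shift costs the symbol no more than the factor
  \<open>(1 + \<bar>\<tau>\<bar>) powr \<bar>m\<bar>\<close>, so that \<open>k powr m\<close> still balances its size. The transform of \<open>\<eta>\<close> absorbs this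
  factor and leaves two more powers, which make the bound integrable in \<open>\<tau>\<close>.\<close>

lemma modulated_integrand_bound:
  fixes r p :: "real \<Rightarrow> real" and s q m :: real
  assumes c: "classical_symbol (- m) c P" and \<eta>: "test_function \<eta>" and s: "\<bar>s\<bar> = 1"
    and K: "compact K"
    and r: "((\<lambda>k. r k / k) \<longlongrightarrow> 1) at_top" and p: "(p \<longlongrightarrow> q) at_top"
  shows "\<exists>B\<ge>0. \<forall>\<^sub>F k in at_top. \<forall>y\<in>K. \<forall>\<tau>. norm (of_real (k powr m) * c (y, \<tau> - s * r k) *
      fourier_laplace \<eta> (of_real \<tau> - \<i> * of_real (s * p k))) \<le> B * inverse ((1 + \<bar>\<tau>\<bar>)\<^sup>2)"
proof -
  define n where "n = nat \<lceil>\<bar>m\<bar>\<rceil>"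
  obtain C where C: "C \<ge> 0" "\<forall>y\<in>K. \<forall>\<xi>. norm (c (y, \<xi>)) \<le> C * (1 + \<bar>\<xi>\<bar>) powr (- m)"
    using classical_symbol_order[OF c K] by blast
  obtain C' where C': "\<forall>\<zeta>. \<bar>Im \<zeta>\<bar> \<le> \<bar>q\<bar> + 1 \<longrightarrow> (1 + \<bar>Re \<zeta>\<bar>) ^ (n + 2) * norm (fourier_laplace \<eta> \<zeta>) \<le> C'"
    using fourier_laplace_decay[OF \<eta>] by blast
  have "norm (fourier_laplace \<eta> 0) \<le> C'"
    using C'[rule_format, of 0] by simp
  then have C'_nonneg: "C' \<ge> 0" by (rule order_trans[OF norm_ge_zero])
  have "((\<lambda>k. \<bar>r k\<bar> / k) \<longlongrightarrow> 1) at_top"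
  proof -
    have "((\<lambda>k. \<bar>r k / k\<bar>) \<longlongrightarrow> \<bar>1\<bar>) at_top" by (intro tendsto_intros r)
    moreover have "\<forall>\<^sub>F k in at_top. \<bar>r k / k\<bar> = \<bar>r k\<bar> / k"
      using eventually_gt_at_top[of 0] by eventually_elim (simp add: abs_divide)
    ultimately show ?thesis using Lim_transform_eventually by fastforce
  qed
  then have "((\<lambda>k. ((1 + \<bar>r k\<bar>) / k) powr (- m)) \<longlongrightarrow> 1 powr (- m)) at_top"
    by (intro tendsto_intros tendsto_one_plus_over) simp_all
  then have ev1: "\<forall>\<^sub>F k in at_top. ((1 + \<bar>r k\<bar>) / k) powr (- m) < 2"
    by (rule order_tendstoD) simp
  have ev2: "\<forall>\<^sub>F k in at_top. \<bar>p k\<bar> < \<bar>q\<bar> + 1"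
    using tendsto_rabs[OF p] by (rule order_tendstoD) simp
  have "\<forall>\<^sub>F k in at_top. \<forall>y\<in>K. \<forall>\<tau>. norm (of_real (k powr m) * c (y, \<tau> - s * r k) *
      fourier_laplace \<eta> (of_real \<tau> - \<i> * of_real (s * p k))) \<le> 2 * C * C' * inverse ((1 + \<bar>\<tau>\<bar>)\<^sup>2)"
    using ev1 ev2 eventually_gt_at_top[of 0]
  proof eventually_elim
    case (elim k)
    show ?case
    proof (intro ballI allI)
      fix y \<tau> :: real assume y: "y \<in> K"
      define t where "t = 1 + \<bar>\<tau>\<bar>"
      have t: "t \<ge> 1" unfolding t_def by simp
      have "k powr m * norm (c (y, \<tau> - s * r k)) \<le> k powr m * (C * (1 + \<bar>\<tau> - s * r k\<bar>) powr (- m))"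
        using C(2) y by (intro mult_left_mono) auto
      also have "\<dots> \<le> k powr m * (C * ((1 + \<bar>s * r k\<bar>) powr (- m) * t powr \<bar>m\<bar>))"
        unfolding t_def using C(1) by (intro mult_left_mono peetre_inequality) auto
      also have "\<dots> = C * ((1 + \<bar>r k\<bar>) / k) powr (- m) * t powr \<bar>m\<bar>"
        using elim(3) s by (simp add: abs_mult powr_divide powr_minus field_simps)
      also have "\<dots> \<le> C * 2 * t powr real n"
      proof (intro mult_mono powr_mono)
        show "\<bar>m\<bar> \<le> real n" unfolding n_def by linarith
      qed (use elim C(1) t in auto)
      also have "\<dots> = C * 2 * t ^ n" using t by (simp add: powr_realpow)
      finally have 1: "k powr m * norm (c (y, \<tau> - s * r k)) \<le> C * 2 * t ^ n" .
      have "\<bar>s * p k\<bar> \<le> \<bar>q\<bar> + 1" using elim(2) s by (simp add: abs_mult)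
      then have "t ^ (n + 2) * norm (fourier_laplace \<eta> (of_real \<tau> - \<i> * of_real (s * p k))) \<le> C'"
        using C'[rule_format, of "of_real \<tau> - \<i> * of_real (s * p k)"] by (simp add: t_def)
      then have 2: "norm (fourier_laplace \<eta> (of_real \<tau> - \<i> * of_real (s * p k))) \<le> C' / t ^ (n + 2)"
        using t by (simp add: field_simps)
      have "norm (of_real (k powr m) * c (y, \<tau> - s * r k) * fourier_laplace \<eta> (of_real \<tau> - \<i> * of_real (s * p k)))
          = (k powr m * norm (c (y, \<tau> - s * r k))) * norm (fourier_laplace \<eta> (of_real \<tau> - \<i> * of_real (s * p k)))"
        by (simp add: norm_mult)
      also have "\<dots> \<le> (C * 2 * t ^ n) * (C' / t ^ (n + 2))"
        using C(1) t by (intro mult_mono 1 2) auto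
      also have "\<dots> = 2 * C * C' * inverse (t\<^sup>2)"
        using t by (simp add: power_add power2_eq_square field_simps)
      finally show "norm (of_real (k powr m) * c (y, \<tau> - s * r k) *
          fourier_laplace \<eta> (of_real \<tau> - \<i> * of_real (s * p k))) \<le> 2 * C * C' * inverse ((1 + \<bar>\<tau>\<bar>)\<^sup>2)"
        unfolding t_def .
    qed
  qed
  then show ?thesis using C(1) C'_nonneg by (intro exI[of _ "2 * C * C'"]) simp
qed

text \<open>The frequencies \<open>\<tau>\<close> that matter in the inner integral stay bounded, while the argument of the
  symbol moves to infinity; there the symbol is asymptotic to its principal part, which does not
  depend on the sign of the frequency and hence not on \<open>s\<close>. What remains is a Fourier inversion,
  which yields the second factor \<open>\<eta>\<close>.\<close>

lemma modulated_covariance_limit: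
  fixes \<kappa> :: "real \<Rightarrow> complex" and \<eta> :: "real \<Rightarrow> complex" and s x q m :: real
  assumes c: "classical_symbol (- m) c (\<lambda>(x, \<xi>). of_real (\<mu> x * \<bar>\<xi>\<bar> powr (- m)))"
    and \<eta>: "test_function_on {0<..<1} \<eta>" and real: "\<And>y. cnj (\<eta> y) = \<eta> y" and s: "\<bar>s\<bar> = 1"
    and r: "((\<lambda>k. Re (\<kappa> k) / k) \<longlongrightarrow> 1) at_top" and p: "((\<lambda>k. Im (\<kappa> k)) \<longlongrightarrow> q) at_top"
  defines "\<phi> \<equiv> \<lambda>k y. \<eta> y * exp (\<i> * \<kappa> k * of_real (s * (y - x)))"
  shows "((\<lambda>k. of_real (k powr m) * (\<integral>y. \<phi> k y * psido c (\<lambda>y. cnj (\<phi> k y)) y \<partial>lborel)) \<longlongrightarrow>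
    (\<integral>y. (\<eta> y)\<^sup>2 * of_real (exp (2 * s * q * (x - y)) * \<mu> y) \<partial>lborel)) at_top"
proof -
  have tf: "test_function \<eta>" using \<eta> by (rule test_function_on_imp_test_function)
  define I where "I k y \<tau> = of_real (k powr m) * c (y, \<tau> - s * Re (\<kappa> k)) *
      fourier_laplace \<eta> (of_real \<tau> - \<i> * of_real (s * Im (\<kappa> k)))" for k y \<tau>
  define G where "G k y = (\<integral>\<tau>. exp (\<i> * of_real (y * \<tau>)) * I k y \<tau> \<partial>lborel)" for k y
  define F where "F k y = \<eta> y * of_real (exp (s * Im (\<kappa> k) * (2 * x - y)) / (2 * pi)) * G k y" for k y
  have c_meas [measurable]: "c \<in> borel_measurable borel"
    by (rule borel_measurable_continuous_onI[OF classical_symbol_continuous[OF c]])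
  have FL_meas [measurable]: "(\<lambda>\<tau>. fourier_laplace \<eta> (of_real \<tau> - \<i> * of_real b)) \<in> borel_measurable borel" for b
    by (rule borel_measurable_continuous_onI[OF continuous_fourier_laplace_line[OF tf]])
  have \<eta>_meas [measurable]: "\<eta> \<in> borel_measurable borel"
    using \<eta> unfolding test_function_on_def by (intro borel_measurable_continuous_onI smooth_on_continuous) auto
  have shift_meas [measurable]: "(\<lambda>p. c (fst p, snd p - b)) \<in> borel_measurable (lborel \<Otimes>\<^sub>M lborel)" for b :: real
    by (rule measurable_compose[OF _ c_meas]) (simp add: borel_prod[symmetric])
  have G_meas [measurable]: "G k \<in> borel_measurable lborel" for k
  proof -
    have "(\<lambda>p. exp (\<i> * of_real (fst p * snd p)) * I k (fst p) (snd p)) \<in> borel_measurable (lborel \<Otimes>\<^sub>M lborel)"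
      unfolding I_def by measurable
    then show ?thesis
      unfolding G_def by (intro lborel.borel_measurable_lebesgue_integral) (simp add: case_prod_unfold)
  qed
  obtain B where B: "B \<ge> 0" and "\<forall>\<^sub>F k in at_top. \<forall>y\<in>{0..1}. \<forall>\<tau>. norm (I k y \<tau>) \<le> B * inverse ((1 + \<bar>\<tau>\<bar>)\<^sup>2)"
    using modulated_integrand_bound[OF c tf s compact_Icc r p] unfolding I_def by blast
  note I_bound = this(2)
  have exp1: "norm (exp (\<i> * of_real t)) = 1" for t :: real by simp
  let ?J = "\<integral>\<tau>. B * inverse ((1 + \<bar>\<tau>\<bar>)\<^sup>2) \<partial>lborel"
  have dom: "integrable lborel (\<lambda>\<tau>::real. B * inverse ((1 + \<bar>\<tau>\<bar>)\<^sup>2))"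
    by (intro integrable_mult_right integrable_inverse_square)
  have I_meas: "(\<lambda>\<tau>. exp (\<i> * of_real (y * \<tau>)) * I k y \<tau>) \<in> borel_measurable lborel" for k y
  proof -
    have "(\<lambda>\<tau>. c (y, \<tau> - b)) \<in> borel_measurable borel" for b
      by (rule measurable_compose[OF _ c_meas]) (simp add: borel_prod[symmetric])
    then show ?thesis unfolding I_def by measurable
  qed
  have G_bound: "\<forall>\<^sub>F k in at_top. \<forall>y\<in>{0..1}. norm (G k y) \<le> ?J"
    using I_bound
  proof eventually_elim
    case (elim k)
    show ?case
    proof
      fix y :: real assume y: "y \<in> {0..1}"
      have le: "norm (exp (\<i> * of_real (y * \<tau>)) * I k y \<tau>) \<le> B * inverse ((1 + \<bar>\<tau>\<bar>)\<^sup>2)" for \<tau>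
        using elim y unfolding norm_mult exp1 by simp
      have "integrable lborel (\<lambda>\<tau>. exp (\<i> * of_real (y * \<tau>)) * I k y \<tau>)"
        by (rule Bochner_Integration.integrable_bound[OF dom I_meas])
           (use le B in \<open>auto simp: abs_mult\<close>)
      then show "norm (G k y) \<le> ?J"
        unfolding G_def using le dom
        by (intro order_trans[OF integral_norm_bound] integral_mono integrable_norm)
    qed
  qed
  have G_lim: "((\<lambda>k. G k y) \<longlongrightarrow> of_real (\<mu> y) * (of_real (2 * pi * exp (- (s * q) * y)) * \<eta> y)) at_top"
    if y: "y \<in> {0..1}" for y
  proof -
    have "((\<lambda>k. G k y) \<longlongrightarrow> (\<integral>\<tau>. exp (\<i> * of_real (y * \<tau>)) *
        (of_real (\<mu> y) * fourier_laplace \<eta> (of_real \<tau> - \<i> * of_real (s * q))) \<partial>lborel)) at_top"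
      unfolding G_def
    proof (rule integral_dominated_convergence_at_top[OF _ I_meas dom])
      show "(\<lambda>\<tau>. exp (\<i> * of_real (y * \<tau>)) *
          (of_real (\<mu> y) * fourier_laplace \<eta> (of_real \<tau> - \<i> * of_real (s * q)))) \<in> borel_measurable lborel"
        by measurable
      show "\<forall>\<^sub>F k in at_top. AE \<tau> in lborel. norm (exp (\<i> * of_real (y * \<tau>)) * I k y \<tau>) \<le> B * inverse ((1 + \<bar>\<tau>\<bar>)\<^sup>2)"
        using I_bound by eventually_elim (use y in \<open>simp add: norm_mult exp1\<close>)
      show "AE \<tau> in lborel. ((\<lambda>k. exp (\<i> * of_real (y * \<tau>)) * I k y \<tau>) \<longlongrightarrow> exp (\<i> * of_real (y * \<tau>)) *
          (of_real (\<mu> y) * fourier_laplace \<eta> (of_real \<tau> - \<i> * of_real (s * q)))) at_top"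
      proof (rule AE_I2)
        fix \<tau> :: real
        have "((\<lambda>k. \<bar>\<tau> - s * Re (\<kappa> k)\<bar> / k) \<longlongrightarrow> 1) at_top"
        proof -
          have inv: "((\<lambda>k::real. 1 / k) \<longlongrightarrow> 0) at_top" by real_asymp
          have "((\<lambda>k. \<bar>\<tau> * (1 / k) - s * (Re (\<kappa> k) / k)\<bar>) \<longlongrightarrow> \<bar>\<tau> * 0 - s * 1\<bar>) at_top"
            by (intro tendsto_intros r inv)
          moreover have "\<forall>\<^sub>F k in at_top. \<bar>\<tau> * (1 / k) - s * (Re (\<kappa> k) / k)\<bar> = \<bar>\<tau> - s * Re (\<kappa> k)\<bar> / k"
            using eventually_gt_at_top[of 0]
          proof eventually_elim
            case (elim k)
            have "\<tau> * (1 / k) - s * (Re (\<kappa> k) / k) = (\<tau> - s * Re (\<kappa> k)) / k"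
              by (simp add: diff_divide_distrib)
            then show ?case using elim by (simp add: abs_divide)
          qed
          ultimately show ?thesis using s Lim_transform_eventually by fastforce
        qed
        from classical_symbol_limit[OF c this]
        have "((\<lambda>k. of_real (k powr m) * c (y, \<tau> - s * Re (\<kappa> k))) \<longlongrightarrow> of_real (\<mu> y)) at_top" .
        moreover have "((\<lambda>k. fourier_laplace \<eta> (of_real \<tau> - \<i> * of_real (s * Im (\<kappa> k)))) \<longlongrightarrow>
            fourier_laplace \<eta> (of_real \<tau> - \<i> * of_real (s * q))) at_top"
          by (rule isCont_tendsto_compose[OF fourier_laplace_continuous[OF tf]]) (intro tendsto_intros p)
        ultimately show "((\<lambda>k. exp (\<i> * of_real (y * \<tau>)) * I k y \<tau>) \<longlongrightarrow> exp (\<i> * of_real (y * \<tau>)) *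
          (of_real (\<mu> y) * fourier_laplace \<eta> (of_real \<tau> - \<i> * of_real (s * q)))) at_top"
          unfolding I_def by (intro tendsto_intros)
      qed
    qed
    also have "(\<integral>\<tau>. exp (\<i> * of_real (y * \<tau>)) *
        (of_real (\<mu> y) * fourier_laplace \<eta> (of_real \<tau> - \<i> * of_real (s * q))) \<partial>lborel) =
        of_real (\<mu> y) * (\<integral>\<tau>. exp (\<i> * of_real (y * \<tau>)) * fourier_laplace \<eta> (of_real \<tau> - \<i> * of_real (s * q)) \<partial>lborel)"
      by (subst integral_mult_right_zero[symmetric]) (simp only: mult_ac)
    finally show ?thesis unfolding fourier_laplace_inversion[OF tf] .
  qed
  have off: "\<eta> y = 0" if "y \<notin> {0..1}" for y
  proof (rule not_in_tsupp[of y \<eta>])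
    have "tsupp \<eta> \<subseteq> {0<..<1}" using \<eta> unfolding test_function_on_def by blast
    then show "y \<notin> tsupp \<eta>" using that by fastforce
  qed
  have "((\<lambda>k. \<integral>y. F k y \<partial>lborel) \<longlongrightarrow>
      (\<integral>y. (\<eta> y)\<^sup>2 * of_real (exp (2 * s * q * (x - y)) * \<mu> y) \<partial>lborel)) at_top"
  proof (rule integral_dominated_convergence_at_top)
    let ?M = "exp ((\<bar>q\<bar> + 1) * (2 * \<bar>x\<bar> + 1)) / (2 * pi) * ?J"
    have pointwise: "((\<lambda>k. F k y) \<longlongrightarrow> (\<eta> y)\<^sup>2 * of_real (exp (2 * s * q * (x - y)) * \<mu> y)) at_top" for y
    proof (cases "y \<in> {0..1}")
      case True
      have "((\<lambda>k. F k y) \<longlongrightarrow> \<eta> y * of_real (exp (s * q * (2 * x - y)) / (2 * pi)) *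
          (of_real (\<mu> y) * (of_real (2 * pi * exp (- (s * q) * y)) * \<eta> y))) at_top"
        unfolding F_def by (intro tendsto_intros p G_lim True) simp
      moreover have "exp (2 * s * q * (x - y)) = exp (s * q * (2 * x - y)) * exp (- (s * q) * y)"
        unfolding exp_add[symmetric] by (simp add: algebra_simps)
      ultimately show ?thesis by (simp add: power2_eq_square mult_ac)
    next
      case False
      then show ?thesis by (simp add: F_def off)
    qed
    then show "AE y in lborel. ((\<lambda>k. F k y) \<longlongrightarrow> (\<eta> y)\<^sup>2 * of_real (exp (2 * s * q * (x - y)) * \<mu> y)) at_top"
      by simp
    show F_meas: "F k \<in> borel_measurable lborel" for k unfolding F_def by measurable
    show "(\<lambda>y. (\<eta> y)\<^sup>2 * of_real (exp (2 * s * q * (x - y)) * \<mu> y)) \<in> borel_measurable lborel"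
    proof (rule borel_measurable_LIMSEQ_metric)
      show "(\<lambda>y. F (real n) y) \<in> borel_measurable lborel" for n by (rule F_meas)
      show "(\<lambda>n. F (real n) y) \<longlonglongrightarrow> (\<eta> y)\<^sup>2 * of_real (exp (2 * s * q * (x - y)) * \<mu> y)" for y
        by (rule filterlim_compose[OF pointwise filterlim_real_sequentially])
    qed
    show "integrable lborel (\<lambda>y. norm (\<eta> y) * ?M)"
      using integrable_mult_test_function[OF tf, of "\<lambda>_. 1"] by (intro integrable_mult_left integrable_norm) simp
    have "\<forall>\<^sub>F k in at_top. \<bar>Im (\<kappa> k)\<bar> < \<bar>q\<bar> + 1"
      using tendsto_rabs[OF p] by (rule order_tendstoD) simp
    then show "\<forall>\<^sub>F k in at_top. AE y in lborel. norm (F k y) \<le> norm (\<eta> y) * ?M"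
      using G_bound
    proof eventually_elim
      case (elim k)
      show ?case
      proof (rule AE_I2)
        fix y
        show "norm (F k y) \<le> norm (\<eta> y) * ?M"
        proof (cases "y \<in> {0..1}")
          case True
          have "s * Im (\<kappa> k) * (2 * x - y) \<le> \<bar>s * Im (\<kappa> k)\<bar> * \<bar>2 * x - y\<bar>"
            by (metis abs_ge_self abs_mult)
          also have "\<dots> \<le> (\<bar>q\<bar> + 1) * (2 * \<bar>x\<bar> + 1)"
            using elim(1) s True by (intro mult_mono) (auto simp: abs_mult)
          finally have le: "exp (s * Im (\<kappa> k) * (2 * x - y)) / (2 * pi) * norm (G k y) \<le> ?M"
            using elim(2) True by (intro mult_mono divide_right_mono) auto
          have "norm (F k y) = norm (\<eta> y) * (\<bar>exp (s * Im (\<kappa> k) * (2 * x - y)) / (2 * pi)\<bar> * norm (G k y))"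
            by (simp only: F_def norm_mult norm_of_real mult.assoc)
          also have "\<bar>exp (s * Im (\<kappa> k) * (2 * x - y)) / (2 * pi)\<bar> = exp (s * Im (\<kappa> k) * (2 * x - y)) / (2 * pi)"
            by (rule abs_of_nonneg) simp
          also have "norm (\<eta> y) * (exp (s * Im (\<kappa> k) * (2 * x - y)) / (2 * pi) * norm (G k y)) \<le> norm (\<eta> y) * ?M"
            using le by (rule mult_left_mono) simp
          finally show ?thesis .
        next
          case False
          then show ?thesis by (simp add: F_def off)
        qed
      qed
    qed
  qed
  moreover have "of_real (k powr m) * (\<integral>y. \<phi> k y * psido c (\<lambda>y. cnj (\<phi> k y)) y \<partial>lborel) = (\<integral>y. F k y \<partial>lborel)" for k
  proof -
    have "F k y = of_real (k powr m) * (\<phi> k y * psido c (\<lambda>y. cnj (\<phi> k y)) y)" for y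
    proof -
      have "G k y = of_real (k powr m) * (\<integral>\<tau>. exp (\<i> * of_real (y * \<tau>)) * c (y, \<tau> - s * Re (\<kappa> k)) *
          fourier_laplace \<eta> (of_real \<tau> - \<i> * of_real (s * Im (\<kappa> k))) \<partial>lborel)"
        unfolding G_def I_def by (subst integral_mult_right_zero[symmetric]) (simp only: mult_ac)
      moreover have "\<phi> k y * psido c (\<lambda>y. cnj (\<phi> k y)) y =
          \<eta> y * of_real (exp (s * Im (\<kappa> k) * (2 * x - y)) / (2 * pi)) *
          (\<integral>\<tau>. exp (\<i> * of_real (y * \<tau>)) * c (y, \<tau> - s * Re (\<kappa> k)) *
            fourier_laplace \<eta> (of_real \<tau> - \<i> * of_real (s * Im (\<kappa> k))) \<partial>lborel)"
        unfolding \<phi>_def by (rule psido_modulated[OF real])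
      ultimately show ?thesis
        unfolding F_def by (simp only: mult_ac)
    qed
    then show ?thesis by simp
  qed
  ultimately show ?thesis by simp
qed

section \<open>The radiated field\<close>

text \<open>For a real-valued field the second moment of a complex pairing is a value of the bilinear
  covariance, taken at the test function and its conjugate.\<close>

lemma second_moment_eq_covariance:
  assumes f: "\<And>\<omega>. \<omega> \<in> space M \<Longrightarrow> real_valued_distribution (f \<omega>)" and \<phi>: "test_function \<phi>"
  shows "of_real (\<integral>\<omega>. (norm (f \<omega> \<phi>))\<^sup>2 \<partial>M) = covariance_op M f (\<lambda>y. cnj (\<phi> y)) \<phi>"
proof -
  have "covariance_op M f (\<lambda>y. cnj (\<phi> y)) \<phi> = (\<integral>\<omega>. of_real ((norm (f \<omega> \<phi>))\<^sup>2) \<partial>M)"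
    unfolding covariance_op_def
    by (intro Bochner_Integration.integral_cong refl)
       (simp add: real_valued_distribution_cnj[OF f \<phi>] complex_norm_square[symmetric])
  then show ?thesis by (simp only: integral_complex_of_real)
qed

theorem theorem3p1:
  fixes M :: "'w measure"
    and f :: "'w \<Rightarrow> (real \<Rightarrow> complex) \<Rightarrow> complex"
    and \<mu> :: "real \<Rightarrow> real"
    and \<sigma> m q a b x :: real
    and D U :: "real set"
  assumes "prob_space M"
    and "\<sigma> > 0"
    and D: "D = {0<..<1}"
    and "q > 1"
    and "- (q / 2) < m" and "m \<le> 1"
    and "random_distribution M f"
    and "\<And>\<omega>. \<omega> \<in> space M \<Longrightarrow> real_valued_distribution (f \<omega>)"
    and "\<And>\<omega>. \<omega> \<in> space M \<Longrightarrow> compact (dist_supp (f \<omega>)) \<and> dist_supp (f \<omega>) \<subseteq> D"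
    and "gaussian_field M f"
    and "centered M f"
    and "test_function_on D \<mu>"
    and "\<And>y. \<mu> y \<ge> 0"
    and "microlocally_isotropic M f m \<mu>"
    and "U = {a<..<b}" and "U \<subseteq> UNIV - closure D"
    and "x \<in> U"
  shows "((\<lambda>k. 4 * k powr (m + 2) *
             (\<integral>\<omega>. (norm (radiated_field \<sigma> k D (f \<omega>) x))\<^sup>2 \<partial>M))
          \<longlongrightarrow> (LINT y:D|lborel. exp (- \<sigma> * \<bar>x - y\<bar>) * \<mu> y)) at_top"
proof -
  note prob = \<open>prob_space M\<close> and sigma = \<open>\<sigma> > 0\<close> and random = \<open>random_distribution M f\<close>
    and real = assms(8)
  have supp: "compact (dist_supp (f \<omega>)) \<and> dist_supp (f \<omega>) \<subseteq> {0<..<1}" if "\<omega> \<in> space M" for \<omega>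
    using assms(9)[OF that] D by simp
  obtain c where c: "classical_symbol (- m) c (\<lambda>(x, \<xi>). of_real (\<mu> x * \<bar>\<xi>\<bar> powr (- m)))"
    and cov: "\<And>\<phi> \<psi>. test_function \<phi> \<Longrightarrow> test_function \<psi> \<Longrightarrow>
           covariance_op M f \<psi> \<phi> = (\<integral>x. \<phi> x * psido c \<psi> x \<partial>lborel)"
    using assms(14) unfolding microlocally_isotropic_def by blast
  obtain S where S: "smooth_step S" using classical_symbol_imp_smooth_step[OF c] by blast
  obtain A0 where A0: "A0 > 0" and unif: "\<And>\<phi>. test_function \<phi> \<Longrightarrow> tsupp \<phi> \<inter> {1 / A0..1 - 1 / A0} = {} \<Longrightarrow>
      AE \<omega> in M. f \<omega> \<phi> = 0"
    using gaussian_field_uniform_support[OF prob S real supp assms(10,11)] by blast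
  have "compact (tsupp \<mu>)" "tsupp \<mu> \<subseteq> {0<..<1}"
    using assms(12) D unfolding test_function_on_def by auto
  then obtain A1 where A1: "A1 > 0" "\<And>A. A > A1 \<Longrightarrow> tsupp \<mu> \<subseteq> {1 / A<..<1 - 1 / A}"
    using compact_subset_unit_interval by blast
  \<comment> \<open>The cutoff has to be \<open>1\<close> both where the field lives and where \<open>\<mu>\<close> is nonzero.\<close>
  define A where "A = max A0 A1 + 1"
  have A: "A > A0" "A > A1" "A > 0" unfolding A_def using A0 by auto
  define \<eta> where "\<eta> = cutoff S A"
  have \<eta>: "test_function_on {0<..<1} \<eta>" unfolding \<eta>_def using test_function_cutoff[OF S A(3)] .
  have \<eta>_real: "cnj (\<eta> y) = \<eta> y" for y unfolding \<eta>_def cutoff_def by simp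
  have \<eta>_one: "\<eta> y = 1" if "\<mu> y \<noteq> 0" for y
  proof -
    have "y \<in> tsupp \<mu>" using that not_in_tsupp[of y \<mu>] by blast
    then show ?thesis
      using A1(2)[OF A(2)] unfolding \<eta>_def by (intro cutoff_eq_1[OF S A(3)]) auto
  qed

  \<comment> \<open>\<open>D\<close> lies on one side of \<open>x\<close>, so that \<open>\<bar>x - y\<bar>\<close> is an affine function of \<open>y \<in> D\<close>.\<close>
  have "x \<notin> {0..1}" using assms(16,17) D by auto
  define s :: real where "s = (if x < 0 then 1 else - 1)"
  have s: "\<bar>s\<bar> = 1" unfolding s_def by simp
  have side: "\<bar>x - y\<bar> = s * (y - x)" if "y \<in> {0<..<1}" for y
    using that \<open>x \<notin> {0..1}\<close> unfolding s_def by auto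

  define \<kappa> where "\<kappa> = wave_number \<sigma>"
  define \<phi> where "\<phi> k y = \<eta> y * exp (\<i> * \<kappa> k * of_real (s * (y - x)))" for k y
  define J where "J k = (\<integral>\<omega>. (norm (f \<omega> (\<phi> k)))\<^sup>2 \<partial>M)" for k
  have smooth: "smooth_on UNIV (\<lambda>y. exp (\<i> * \<kappa> k * complex_of_real (s * (y - x))))" for k
  proof -
    have "exp (\<i> * \<kappa> k * complex_of_real (s * (y - x))) =
        exp (- (\<i> * \<kappa> k * of_real (s * x))) * exp ((\<i> * \<kappa> k * of_real s) * of_real y)" for y
      unfolding exp_add[symmetric] by (simp add: algebra_simps)
    then show ?thesis
      using smooth_on_mult[OF smooth_on_const smooth_on_exp] by simp
  qed
  have \<phi>: "test_function (\<phi> k)" for k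
    using test_function_on_mult[OF \<eta> smooth] unfolding \<phi>_def by (rule test_function_on_imp_test_function)

  have moment: "(\<integral>\<omega>. (norm (radiated_field \<sigma> k D (f \<omega>) x))\<^sup>2 \<partial>M) = J k / (4 * (norm (\<kappa> k))\<^sup>2)" for k
  proof -
    let ?g = "\<lambda>y. exp (\<i> * \<kappa> k * of_real \<bar>x - y\<bar>)"
    have meas [measurable]: "(\<lambda>\<omega>. ext_pairing {0<..<1} (f \<omega>) ?g) \<in> borel_measurable M"
      and ae: "AE \<omega> in M. ext_pairing {0<..<1} (f \<omega>) ?g = f \<omega> (\<phi> k)"
      using ext_pairing_random[OF S A0 A(1) unif random supp smooth, of ?g k] side
      unfolding \<phi>_def \<eta>_def by auto
    have [measurable]: "(\<lambda>\<omega>. f \<omega> (\<phi> k)) \<in> borel_measurable M"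
      using random \<phi> unfolding random_distribution_def by blast
    have "(\<integral>\<omega>. (norm (radiated_field \<sigma> k D (f \<omega>) x))\<^sup>2 \<partial>M)
        = (\<integral>\<omega>. (norm (ext_pairing {0<..<1} (f \<omega>) ?g))\<^sup>2 / (4 * (norm (\<kappa> k))\<^sup>2) \<partial>M)"
      unfolding radiated_field_def D \<kappa>_def[symmetric]
      by (intro Bochner_Integration.integral_cong refl)
         (simp add: norm_mult norm_divide power_mult_distrib power_divide)
    also have "\<dots> = (\<integral>\<omega>. (norm (f \<omega> (\<phi> k)))\<^sup>2 / (4 * (norm (\<kappa> k))\<^sup>2) \<partial>M)"
    proof (rule integral_cong_AE)
      show "AE \<omega> in M. (norm (ext_pairing {0<..<1} (f \<omega>) ?g))\<^sup>2 / (4 * (norm (\<kappa> k))\<^sup>2)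
          = (norm (f \<omega> (\<phi> k)))\<^sup>2 / (4 * (norm (\<kappa> k))\<^sup>2)"
        using ae by eventually_elim simp
    qed measurable
    finally show ?thesis unfolding J_def by simp
  qed

  let ?L = "LINT y:D|lborel. exp (- \<sigma> * \<bar>x - y\<bar>) * \<mu> y"
  have "((\<lambda>k. of_real (k powr m) * (\<integral>y. \<phi> k y * psido c (\<lambda>y. cnj (\<phi> k y)) y \<partial>lborel)) \<longlongrightarrow>
      (\<integral>y. (\<eta> y)\<^sup>2 * of_real (exp (2 * s * (\<sigma> / 2) * (x - y)) * \<mu> y) \<partial>lborel)) at_top"
    unfolding \<phi>_def \<kappa>_def
    by (rule modulated_covariance_limit[OF c \<eta> \<eta>_real s wave_number_asymptotics(1,2)[OF sigma]])
  also have "(\<integral>y. (\<eta> y)\<^sup>2 * of_real (exp (2 * s * (\<sigma> / 2) * (x - y)) * \<mu> y) \<partial>lborel)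
      = (\<integral>y. of_real (indicator D y *\<^sub>R (exp (- \<sigma> * \<bar>x - y\<bar>) * \<mu> y)) \<partial>lborel)"
  proof (rule Bochner_Integration.integral_cong[OF refl])
    fix y
    show "(\<eta> y)\<^sup>2 * of_real (exp (2 * s * (\<sigma> / 2) * (x - y)) * \<mu> y)
        = complex_of_real (indicator D y *\<^sub>R (exp (- \<sigma> * \<bar>x - y\<bar>) * \<mu> y))"
    proof (cases "\<mu> y = 0")
      case False
      then have y: "y \<in> {0<..<1}"
        using \<open>tsupp \<mu> \<subseteq> {0<..<1}\<close> not_in_tsupp[of y \<mu>] by blast
      have "2 * s * (\<sigma> / 2) * (x - y) = - \<sigma> * \<bar>x - y\<bar>"
        unfolding side[OF y] by (simp add: algebra_simps)
      then show ?thesis using \<eta>_one[OF False] y D by simp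
    qed simp
  qed
  also have "\<dots> = of_real ?L"
    unfolding set_lebesgue_integral_def by (rule integral_complex_of_real)
  also have "(\<lambda>k. of_real (k powr m) * (\<integral>y. \<phi> k y * psido c (\<lambda>y. cnj (\<phi> k y)) y \<partial>lborel)) =
      (\<lambda>k. of_real (k powr m * J k))"
  proof
    fix k
    have "test_function (\<lambda>y. cnj (\<phi> k y))"
    proof (rule test_function_on_shrink[OF \<phi>])
      show "smooth_on UNIV (\<lambda>y. cnj (\<phi> k y))"
        using \<phi> unfolding test_function_on_def by (intro smooth_on_linear_image[OF bounded_linear_cnj]) auto
    qed simp
    then have "of_real (J k) = (\<integral>y. \<phi> k y * psido c (\<lambda>y. cnj (\<phi> k y)) y \<partial>lborel)"
      unfolding J_def using second_moment_eq_covariance[of M f "\<phi> k", OF real \<phi>] cov[OF \<phi>] by simp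
    then show "of_real (k powr m) * (\<integral>y. \<phi> k y * psido c (\<lambda>y. cnj (\<phi> k y)) y \<partial>lborel) = complex_of_real (k powr m * J k)"
      by simp
  qed
  finally have lim: "((\<lambda>k. k powr m * J k) \<longlongrightarrow> ?L) at_top"
    by (simp only: tendsto_of_real_iff)
  have "((\<lambda>k. k\<^sup>2 / (norm (\<kappa> k))\<^sup>2 * (k powr m * J k)) \<longlongrightarrow> 1 * ?L) at_top"
    unfolding \<kappa>_def by (intro tendsto_mult wave_number_asymptotics(3)[OF sigma] lim)
  moreover have "\<forall>\<^sub>F k in at_top. k\<^sup>2 / (norm (\<kappa> k))\<^sup>2 * (k powr m * J k) = 4 * k powr (m + 2) *
      (\<integral>\<omega>. (norm (radiated_field \<sigma> k D (f \<omega>) x))\<^sup>2 \<partial>M)"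
    using eventually_gt_at_top[of 0]
  proof eventually_elim
    case (elim k)
    then have "k powr (m + 2) = k powr m * k\<^sup>2" by (simp add: powr_add)
    then show ?case unfolding moment by simp
  qed
  ultimately show ?thesis using Lim_transform_eventually by fastforce
qed

end
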